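(* Let $(Y,\omega,I,\varphi)$ be a symplectic $\mathbb{C}^*$-manifold over a convex base, with associated $1$-periodic persistence module $(V_p)_{p\in\mathbb{R}\cup\{\infty\}}$ and its barcode. The map $\mathcal{S}_\varphi$ corresponds to a translation symmetry on the barcode: the number of intervals $[a,b)$ equals the number of intervals $[a-1,b-1)$, and analogously for $(-\infty,b)$ and $(-\infty,b-1)$. If the barcode is graded, that translation shifts the grading by $d_j\mapsto d_j+2\mu$, where $\mu$ is the Maslov index of $\varphi$.
   Context: **Symplectic $\mathbb{C}^*$-manifolds over a convex base.** A symplectic $\mathbb{C}^*$-manifold $(Y,\omega,I,\varphi)$ is a connected symplectic manifold with an $\omega$-compatible almost complex structure $I$ and an $I$-pseudoholomorphic $\mathbb{C}^*$-action $\varphi$ whose $S^1$-part is Hamiltonian. The circle $S^1=\mathbb{R}/\mathbb{Z}$ has vector field $X_{S^1}=X_H$, where $H:Y\to\mathbb{R}$ is the moment map, $\omega(\cdot,X_H)=dH$. It is *over a convex base* if on the complement $Y^{\mathrm{out}}$ of the interior of a compact subdomain there is a proper $(I,I_B)$-pseudoholomorphic map $\Psi:Y^{\mathrm{out}}\to B^{\mathrm{out}}=\Sigma\times[R_0,\infty)$, where $(\Sigma,\alpha)$ is a closed contact manifold, $B^{\mathrm{out}}$ carries the symplectic form $d(R\alpha)$ and a compatible almost complex structure $I_B$ of contact type ($dR=R\alpha\circ I_B$) and is geometrically bounded at infinity, such that $\Psi_*X_{S^1}=X_{fR}$ for a Reeb-invariant function $f:\Sigma\to(0,\infty)$ (for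 $f\equiv1$, $X_R$ is the Reeb field). $Y$ is non-compact. The fixed locus is then compact and $H$ is bounded below; $H$ is assumed proper, normalised by $\min H=0$; $\mathfrak{F}_{\min}=\min H$ is a connected component of the fixed locus. **Floer theory.** Let $\dim_{\mathbb{R}}Y=2n$. Standing assumption (weak+ monotonicity): at least one of (1) $c_1(Y)(A)=0$ for all $A\in\pi_2(Y)$; (2) $\omega(A)=0$ for all $A\in\pi_2(Y)$; (3) for some $k>0$, $c_1(Y)(A)=k\,\omega(A)$ for all $A\in\pi_2(Y)$; (4) the smallest positive value of $c_1(Y)$ on $\pi_2(Y)$ is $\ge n-1$. Coefficients are in the Novikov field $\mathbb{K}$ over a base field $\mathbb{B}$ (if $c_1(Y)=0$: $\mathbb{K}=\{\sum n_jT^{a_j}:a_j\in\mathbb{R},a_j\to\infty,n_j\in\mathbb{B}\}$). $QH^*(Y)$ is $H^*(Y;\mathbb{K})$ with quantum product. A slope $\lambda>0$ is *generic* if it is not a period of a non-constant $S^1$-orbit. $H_\lambda$ denotes a Hamiltonian equal to $\lambda H$ at infinity (up to a constant); $HF^*(H_\lambda)$ is its Hamiltonian Floer cohomology over $\mathbb{K}$, with continuation maps $HF^*(H_\lambda)\to HF^*(H_\gamma)$ for generic $\lambda\le\gamma$; for small $\delta>0$, $QH^*(Y)\cong HF^*(H_\delta)$; $SH^*(Y)=\varinjlim HF^*(H_\lambda)$. Gradings are in $\mathbb{Z}$ if $c_1(Y)=0$, in $\mathbb{Z}/2$ in general (or $\mathbb{Z}/2N$ under suitable assumptions); $(A[d])_n=A_{n+d}$.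 **Seidel isomorphism.** $\mu$ is the sum of weights of the linearised $S^1$-action at a point of $\mathfrak{F}_{\min}$ (at any fixed point if $c_1(Y)=0$). $\mathcal{S}_\varphi:HF^*(H_\lambda)\to HF^*(H_{\lambda-1})[2\mu]$ is the isomorphism induced by $x(t)\mapsto\varphi_{e^{-2\pi it}}(x(t))$ on $1$-orbits (lifted to capped orbits so that the constant capping at a point of $\mathfrak{F}_{\min}$ is fixed). It is compatible with continuation maps. **Persistence module.** $V_0:=QH^*(Y)$, $V_p:=HF^*(H_p)$ for generic $p>0$, $V_p:=HF^*(H_{p^+})$ for non-generic $p>0$ with $p^+>p$ sufficiently close to $p$, and $V_\infty:=SH^*(Y)$; $\psi_{p',p}:V_p\to V_{p'}$ ($0\le p\le p'$) are the continuation maps. For $p<0$, $V_p$ is defined by imposing periodicity: $V_p:=V_{p+1}[-2\mu]$, inductively, with $\mathcal{S}_\varphi:=\mathrm{id}:V_{p+1}\to V_p[2\mu]$, and $\psi_{p',p}$ is extended to all $p\le p'$ by requiring $\mathcal{S}_\varphi\circ\psi_{p',p}=\psi_{p'-1,p-1}\circ\mathcal{S}_\varphi$ and $\psi_{p'',p'}\circ\psi_{p',p}=\psi_{p'',p}$. **Barcode.** A basic persistence module supported on an interval $\mathcal{I}$ is $W_p=\mathbb{K}$ for $p\in\mathcal{I}$, $W_p=0$ otherwise, with structure maps the identity between points of $\mathcal{I}$ and zero otherwise. $V$ is (non-canonically) isomorphic to a direct sum of basic persistence modules, supported on intervals of the form $[a,b)$ or $(-\infty,b)$ with $a\in\mathbb{R}$,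 $b\in\mathbb{R}\cup\{\infty\}$ (with $b=\infty$ for bars which persist for all larger $p$; $\infty-1:=\infty$). The barcode is the collection of the supporting intervals $\mathcal{I}_j$ with multiplicities $m_j$; the graded barcode is $(\mathcal{I}_j,m_j,d_j)$ where $m_j$ counts only summands supported on $\mathcal{I}_j$ living in grading $d_j$. *)

theory Defs
  imports "HOL-Analysis.Analysis" "HOL-Homology.Homology"
begin

section \<open>The Novikov field\<close>

text \<open>
  The formal series with coefficient \<open>f a\<close> at \<open>T\<^sup>a\<close>, having finitely many terms of exponent at most any
  given bound.
\<close>


typedef (overloaded) 'b novikov =
  "{f :: real \<Rightarrow> 'b::zero. \<forall>C. finite {a. a \<le> C \<and> f a \<noteq> 0}}"
  morphisms ncoeff Novikov
  by (rule exI[of _ "\<lambda>_. 0"]) simp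

setup_lifting type_definition_novikov

lemma ncoeff_finite: "finite {a. a \<le> C \<and> ncoeff f a \<noteq> 0}"
  using ncoeff[of f] by simp

lemma ncoeff_lower: "\<exists>m. \<forall>a. ncoeff f a \<noteq> 0 \<longrightarrow> m \<le> a"
proof (cases "\<exists>a. ncoeff f a \<noteq> 0")
  case True
  then obtain a0 where a0: "ncoeff f a0 \<noteq> 0" by blast
  let ?A = "{a. a \<le> a0 \<and> ncoeff f a \<noteq> 0}"
  have "\<forall>a. ncoeff f a \<noteq> 0 \<longrightarrow> Min ?A \<le> a"
  proof (intro allI impI)
    fix a assume a: "ncoeff f a \<noteq> 0"
    have "Min ?A \<le> a0" using a0 by (intro Min_le ncoeff_finite) auto
    then show "Min ?A \<le> a" using a
      by (cases "a \<le> a0") (auto intro!: Min_le ncoeff_finite)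
  qed
  then show ?thesis by blast
qed auto

definition nconv :: "(real \<Rightarrow> 'b::semiring_0) \<Rightarrow> (real \<Rightarrow> 'b) \<Rightarrow> real \<Rightarrow> 'b" where
  "nconv f g c = (\<Sum>a\<in>{a. f a \<noteq> 0 \<and> g (c - a) \<noteq> 0}. f a * g (c - a))"

lemma nconv_nonzero:
  assumes "nconv f g c \<noteq> 0" shows "\<exists>a. f a \<noteq> 0 \<and> g (c - a) \<noteq> 0"
proof (rule ccontr)
  assume "\<nexists>a. f a \<noteq> 0 \<and> g (c - a) \<noteq> 0"
  then have "{a. f a \<noteq> 0 \<and> g (c - a) \<noteq> 0} = {}" by blast
  with assms show False by (simp add: nconv_def)
qed

lemma nconv_left:
  assumes "finite A" "\<And>a. f a \<noteq> 0 \<Longrightarrow> g (c - a) \<noteq> 0 \<Longrightarrow> a \<in> A"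
  shows "nconv f g c = (\<Sum>a\<in>A. f a * g (c - a))"
  unfolding nconv_def using assms by (intro sum.mono_neutral_left) auto

lemma nconv_commute: "nconv f g c = nconv g f (c::real)"
  for f :: "real \<Rightarrow> 'b::comm_semiring_0"
  unfolding nconv_def
  by (rule sum.reindex_bij_witness[of _ "\<lambda>a. c - a" "\<lambda>a. c - a"]) (auto simp: mult.commute)

lemma nconv_finite_support:
  fixes f g :: "'b::semiring_0 novikov"
  shows "finite {c. c \<le> C \<and> nconv (ncoeff f) (ncoeff g) c \<noteq> 0}"
proof -
  obtain m where m: "\<And>a. ncoeff f a \<noteq> 0 \<Longrightarrow> m \<le> a" using ncoeff_lower by blast
  obtain k where k: "\<And>a. ncoeff g a \<noteq> 0 \<Longrightarrow> k \<le> a" using ncoeff_lower by blast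
  let ?A = "{a. a \<le> C - k \<and> ncoeff f a \<noteq> 0}" and ?B = "{a. a \<le> C - m \<and> ncoeff g a \<noteq> 0}"
  have "{c. c \<le> C \<and> nconv (ncoeff f) (ncoeff g) c \<noteq> 0} \<subseteq> (\<lambda>(a,b). a + b) ` (?A \<times> ?B)"
  proof
    fix c assume "c \<in> {c. c \<le> C \<and> nconv (ncoeff f) (ncoeff g) c \<noteq> 0}"
    then have c: "c \<le> C" "nconv (ncoeff f) (ncoeff g) c \<noteq> 0" by auto
    then obtain a where a: "ncoeff f a \<noteq> 0" "ncoeff g (c - a) \<noteq> 0"
      using nconv_nonzero by blast
    have "a \<in> ?A" "c - a \<in> ?B" using a c m[OF a(1)] k[OF a(2)] by auto
    then show "c \<in> (\<lambda>(a,b). a + b) ` (?A \<times> ?B)" by (intro image_eqI[of _ _ "(a, c - a)"]) auto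
  qed
  then show ?thesis by (rule finite_subset) (intro finite_imageI finite_SigmaI ncoeff_finite)
qed

instantiation novikov :: (comm_ring_1) comm_ring_1
begin

lift_definition zero_novikov :: "'a novikov" is "\<lambda>_. 0" by simp
lift_definition one_novikov :: "'a novikov" is "\<lambda>a. if a = 0 then 1 else 0"
  by (rule finite_subset[of _ "{0}"]) auto
lift_definition plus_novikov :: "'a novikov \<Rightarrow> 'a novikov \<Rightarrow> 'a novikov" is "\<lambda>f g a. f a + g a"
proof -
  fix f g :: "real \<Rightarrow> 'a" and C
  assume "\<And>C. finite {a. a \<le> C \<and> f a \<noteq> 0}" "\<And>C. finite {a. a \<le> C \<and> g a \<noteq> 0}"
  then have "finite ({a. a \<le> C \<and> f a \<noteq> 0} \<union> {a. a \<le> C \<and> g a \<noteq> 0})" by simp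
  then show "finite {a. a \<le> C \<and> f a + g a \<noteq> 0}" by (rule finite_subset[rotated]) auto
qed
lift_definition uminus_novikov :: "'a novikov \<Rightarrow> 'a novikov" is "\<lambda>f a. - f a" by simp
definition minus_novikov :: "'a novikov \<Rightarrow> 'a novikov \<Rightarrow> 'a novikov" where
  "minus_novikov f g = f + - g"
definition times_novikov :: "'a novikov \<Rightarrow> 'a novikov \<Rightarrow> 'a novikov" where
  "times_novikov f g = Novikov (nconv (ncoeff f) (ncoeff g))"

lemma ncoeff_times: "ncoeff (f * g) = nconv (ncoeff f) (ncoeff g)"
  unfolding times_novikov_def by (rule Novikov_inverse) (simp add: nconv_finite_support)

instance
proof
  fix a b c :: "'a novikov"
  show "a + b + c = a + (b + c)" "a + b = b + a" "0 + a = a" "- a + a = 0"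
    by (auto intro!: ncoeff_inject[THEN iffD1] simp: plus_novikov.rep_eq zero_novikov.rep_eq
        uminus_novikov.rep_eq add_ac fun_eq_iff)
  show "a - b = a + - b" by (simp add: minus_novikov_def)
  show "a * b = b * a"
    by (intro ncoeff_inject[THEN iffD1] ext) (simp add: ncoeff_times nconv_commute)
  show "(0::'a novikov) \<noteq> 1"
  proof
    assume "(0::'a novikov) = 1"
    then have "ncoeff (0::'a novikov) 0 = ncoeff 1 0" by simp
    then show False by (simp add: zero_novikov.rep_eq one_novikov.rep_eq)
  qed
  have one: "ncoeff (1::'a novikov) = (\<lambda>a. if a = 0 then 1 else 0)" by (simp add: one_novikov.rep_eq)
  show "1 * a = a"
  proof (intro ncoeff_inject[THEN iffD1] ext)
    fix x
    have "nconv (ncoeff 1) (ncoeff a) x = (\<Sum>b\<in>{0}. ncoeff 1 b * ncoeff a (x - b))"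
      by (rule nconv_left) (auto simp: one split: if_splits)
    then show "ncoeff (1 * a) x = ncoeff a x" by (simp add: ncoeff_times one)
  qed
  obtain m where m: "\<And>x. ncoeff a x \<noteq> 0 \<Longrightarrow> m \<le> x" using ncoeff_lower by blast
  obtain k where k: "\<And>x. ncoeff b x \<noteq> 0 \<Longrightarrow> k \<le> x" using ncoeff_lower by blast
  obtain l where l: "\<And>x. ncoeff c x \<noteq> 0 \<Longrightarrow> l \<le> x" using ncoeff_lower by blast
  show "(a + b) * c = a * c + b * c"
  proof (intro ncoeff_inject[THEN iffD1] ext)
    fix x
    let ?C = "{y. y \<le> x - min m k \<and> ncoeff c y \<noteq> 0}"
    have add: "ncoeff (p + q) = (\<lambda>y. ncoeff p y + ncoeff q y)" for p q :: "'a novikov"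
      by (simp add: plus_novikov.rep_eq)
    have r: "nconv (ncoeff c) g x = (\<Sum>y\<in>?C. ncoeff c y * g (x - y))"
      if "\<And>y. g y \<noteq> 0 \<Longrightarrow> ncoeff a y \<noteq> 0 \<or> ncoeff b y \<noteq> 0" for g
    proof (rule nconv_left[OF ncoeff_finite])
      fix y assume "ncoeff c y \<noteq> 0" "g (x - y) \<noteq> 0"
      with that[of "x - y"] m[of "x - y"] k[of "x - y"] show "y \<in> ?C" by auto
    qed
    have rs: "nconv (ncoeff c) (ncoeff (a + b)) x = (\<Sum>y\<in>?C. ncoeff c y * ncoeff (a + b) (x - y))"
      "nconv (ncoeff c) (ncoeff a) x = (\<Sum>y\<in>?C. ncoeff c y * ncoeff a (x - y))"
      "nconv (ncoeff c) (ncoeff b) x = (\<Sum>y\<in>?C. ncoeff c y * ncoeff b (x - y))"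
      by (rule r, force simp: add)+
    show "ncoeff ((a + b) * c) x = ncoeff (a * c + b * c) x"
      unfolding add[of "a * c"] ncoeff_times nconv_commute[of _ "ncoeff c"]
      by (simp only: rs) (simp add: add distrib_left sum.distrib)
  qed
  show "a * b * c = a * (b * c)"
  proof (intro ncoeff_inject[THEN iffD1] ext)
    fix x
    let ?A = "{y. y \<le> x - k - l \<and> ncoeff a y \<noteq> 0}" and ?C = "{y. y \<le> x - m - k \<and> ncoeff c y \<noteq> 0}"
    have 1: "nconv (ncoeff c) (ncoeff (a * b)) x = (\<Sum>z\<in>?C. ncoeff c z * ncoeff (a * b) (x - z))"
    proof (rule nconv_left[OF ncoeff_finite])
      fix z assume z: "ncoeff c z \<noteq> 0" "ncoeff (a * b) (x - z) \<noteq> 0"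
      then obtain y where "ncoeff a y \<noteq> 0" "ncoeff b (x - z - y) \<noteq> 0"
        unfolding ncoeff_times using nconv_nonzero by blast
      with m[of y] k[of "x - z - y"] z show "z \<in> ?C" by auto
    qed
    have 2: "nconv (ncoeff a) (ncoeff (b * c)) x = (\<Sum>y\<in>?A. ncoeff a y * ncoeff (b * c) (x - y))"
    proof (rule nconv_left[OF ncoeff_finite])
      fix z assume z: "ncoeff a z \<noteq> 0" "ncoeff (b * c) (x - z) \<noteq> 0"
      then obtain y where "ncoeff b y \<noteq> 0" "ncoeff c (x - z - y) \<noteq> 0"
        unfolding ncoeff_times using nconv_nonzero by blast
      with k[of y] l[of "x - z - y"] z show "z \<in> ?A" by auto
    qed
    have 3: "ncoeff (a * b) (x - z) = (\<Sum>y\<in>?A. ncoeff a y * ncoeff b (x - z - y))" if "z \<in> ?C" for z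
      unfolding ncoeff_times
    proof (rule nconv_left[OF ncoeff_finite])
      fix y assume "ncoeff a y \<noteq> 0" "ncoeff b (x - z - y) \<noteq> 0"
      with that l[of z] k[of "x - z - y"] show "y \<in> ?A" by auto
    qed
    have 4: "ncoeff (b * c) (x - y) = (\<Sum>z\<in>?C. ncoeff c z * ncoeff b (x - y - z))" if "y \<in> ?A" for y
      unfolding ncoeff_times nconv_commute[of "ncoeff b"]
    proof (rule nconv_left[OF ncoeff_finite])
      fix z assume "ncoeff c z \<noteq> 0" "ncoeff b (x - y - z) \<noteq> 0"
      with that m[of y] k[of "x - y - z"] show "z \<in> ?C" by auto
    qed
    have "ncoeff (a * b * c) x = (\<Sum>z\<in>?C. \<Sum>y\<in>?A. ncoeff c z * (ncoeff a y * ncoeff b (x - z - y)))"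
      unfolding ncoeff_times[of "a * b"] nconv_commute[of _ "ncoeff c"] 1
      by (intro sum.cong refl) (simp add: 3 sum_distrib_left)
    also have "\<dots> = (\<Sum>y\<in>?A. \<Sum>z\<in>?C. ncoeff a y * (ncoeff c z * ncoeff b (x - y - z)))"
      by (subst sum.swap) (intro sum.cong refl, simp add: mult.left_commute diff_diff_eq add.commute)
    also have "\<dots> = ncoeff (a * (b * c)) x"
      unfolding ncoeff_times[of a] 2
      by (intro sum.cong refl) (simp add: 4 sum_distrib_left)
    finally show "ncoeff (a * b * c) x = ncoeff (a * (b * c)) x" .
  qed
qed

end

lemma ncoeff_one: "ncoeff (1::'a::comm_ring_1 novikov) a = (if a = 0 then 1 else 0)" by (simp add: one_novikov.rep_eq)
lemma ncoeff_zero: "ncoeff 0 a = 0" by (simp add: zero_novikov.rep_eq)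
lemma ncoeff_add: "ncoeff (f + g) a = ncoeff f a + ncoeff g (a::real)"
  for f :: "'a::comm_ring_1 novikov" by (simp add: plus_novikov.rep_eq)
lemma ncoeff_diff: "ncoeff (f - g) a = ncoeff f a - ncoeff g (a::real)"
  for f :: "'a::comm_ring_1 novikov"
  unfolding minus_novikov_def by (simp add: ncoeff_add uminus_novikov.rep_eq del: add_uminus_conv_diff)

lemma novikov_eqI: "(\<And>a. ncoeff f a = ncoeff g a) \<Longrightarrow> f = g"
  by (intro ncoeff_inject[THEN iffD1] ext) 

lemma ncoeff_times_eq_local:
  fixes f g h :: "'a::comm_ring_1 novikov"
  assumes "\<And>a. ncoeff f a \<noteq> 0 \<Longrightarrow> 0 \<le> a" and "\<And>a. a \<le> C \<Longrightarrow> ncoeff g a = ncoeff h a"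
  shows "ncoeff (f * g) C = ncoeff (f * h) C"
  proof -
  have *: "ncoeff g (C - a) = ncoeff h (C - a)" if "ncoeff f a \<noteq> 0" for a
    using assms(1)[OF that] assms(2)[of "C - a"] by simp
  show ?thesis unfolding ncoeff_times nconv_def by (intro sum.cong) (auto simp: *)
qed

lemma ncoeff_times_lower:
  fixes f g :: "'a::comm_ring_1 novikov"
  assumes "\<And>a. ncoeff f a \<noteq> 0 \<Longrightarrow> m \<le> a" and "\<And>a. ncoeff g a \<noteq> 0 \<Longrightarrow> k \<le> a"
    and "ncoeff (f * g) c \<noteq> 0"
  shows "m + k \<le> c"
proof -
  obtain a where "ncoeff f a \<noteq> 0" "ncoeff g (c - a) \<noteq> 0"
    using assms(3) nconv_nonzero unfolding ncoeff_times by blast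
  then show ?thesis using assms(1)[of a] assms(2)[of "c - a"] by simp
qed

lemma novikov_one_minus_invertible:
  fixes r :: "'a::comm_ring_1 novikov"
  assumes r: "\<And>a. ncoeff r a \<noteq> 0 \<Longrightarrow> 0 < a"
  shows "\<exists>g. (1 - r) * g = 1"
proof -
  obtain e where e: "e > 0" "\<And>a. ncoeff r a \<noteq> 0 \<Longrightarrow> e \<le> a"
  proof (cases "\<exists>a. ncoeff r a \<noteq> 0")
    case True
    then obtain a0 where a0: "ncoeff r a0 \<noteq> 0" by blast
    let ?A = "{a. a \<le> a0 \<and> ncoeff r a \<noteq> 0}"
    have "Min ?A \<in> ?A" using a0 by (intro Min_in ncoeff_finite) auto
    moreover have "Min ?A \<le> a" if "ncoeff r a \<noteq> 0" for a
    proof (cases "a \<le> a0")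
      case True then show ?thesis using that by (intro Min_le ncoeff_finite) auto
    next
      case False
      have "Min ?A \<le> a0" using a0 by (intro Min_le ncoeff_finite) auto
      with False show ?thesis by simp
    qed
    ultimately show ?thesis using r by (intro that[of "Min ?A"]) auto
  qed (use that[of 1] in auto)
  have pow: "of_nat n * e \<le> a" if "ncoeff (r ^ n) a \<noteq> 0" for n a
    using that
  proof (induction n arbitrary: a)
    case 0 then show ?case by (auto simp: ncoeff_one split: if_splits)
  next
    case (Suc n)
    have "e + of_nat n * e \<le> a"
      by (rule ncoeff_times_lower[of r e "r ^ n"]) (use Suc e in auto)
    then show ?case by (simp add: algebra_simps)
  qed
  define S where "S N = (\<Sum>n<N. r ^ n)" for N
  define N where "N C = nat \<lceil>C / e\<rceil> + 1" for C
  have NC: "C < of_nat (N C) * e" for C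
  proof -
    have "C / e < of_nat (N C)" unfolding N_def by linarith
    then show ?thesis using e(1) by (simp add: field_simps)
  qed
  have st: "ncoeff (S M) a = ncoeff (S K) a" if "a < of_nat K * e" "K \<le> M" for M K a
    using that(2)
  proof (induction M rule: dec_induct)
    case (step M)
    have "of_nat K * e \<le> of_nat M * e" using step e by (simp add: mult_right_mono)
    then have "ncoeff (r ^ M) a = 0" using pow[of M a] that by fastforce
    then show ?case using step by (simp add: S_def ncoeff_add)
  qed simp
  define G where "G = Novikov (\<lambda>a. ncoeff (S (N a)) a)"
  have Nmono: "N a \<le> N b" if "a \<le> b" for a b
    unfolding N_def using e(1) that
    by (intro add_mono nat_mono ceiling_mono divide_right_mono) auto
  have G: "ncoeff G = (\<lambda>a. ncoeff (S (N a)) a)" unfolding G_def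
  proof (rule Novikov_inverse, clarify)
    fix C
    have "{a. a \<le> C \<and> ncoeff (S (N a)) a \<noteq> 0} \<subseteq> {a. a \<le> C \<and> ncoeff (S (N C)) a \<noteq> 0}"
    proof
      fix a assume "a \<in> {a. a \<le> C \<and> ncoeff (S (N a)) a \<noteq> 0}"
      then show "a \<in> {a. a \<le> C \<and> ncoeff (S (N C)) a \<noteq> 0}" using st[OF NC Nmono, of a C] by simp
    qed
    then show "finite {a. a \<le> C \<and> ncoeff (S (N a)) a \<noteq> 0}"
      using ncoeff_finite finite_subset by blast
  qed
  have "(1 - r) * G = 1"
  proof (rule novikov_eqI)
    fix C
    have "ncoeff ((1 - r) * G) C = ncoeff ((1 - r) * S (N C)) C"
    proof (rule ncoeff_times_eq_local)
      fix a assume "ncoeff (1 - r) a \<noteq> 0" then show "0 \<le> a"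
        using r[of a] by (cases "ncoeff r a = 0") (auto simp: ncoeff_diff ncoeff_one split: if_splits)
    next
      fix a assume "a \<le> C" then show "ncoeff G a = ncoeff (S (N C)) a"
        unfolding G using st[OF NC Nmono, of a C] by simp
    qed
    also have "(1 - r) * S (N C) = 1 - r ^ N C" unfolding S_def by (rule one_diff_power_eq[symmetric])
    also have "ncoeff (1 - r ^ N C) C = ncoeff 1 C"
      using pow[of "N C" C] NC[of C] by (simp add: ncoeff_diff) argo
    finally show "ncoeff ((1 - r) * G) C = ncoeff 1 C" .
  qed
  then show ?thesis by blast
qed

lift_definition nmonom :: "'a::zero \<Rightarrow> real \<Rightarrow> 'a novikov" is "\<lambda>c a x. if x = a then c else 0"
proof -
  fix c :: 'a and a C :: real
  show "finite {x. x \<le> C \<and> (if x = a then c else 0) \<noteq> 0}"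
    by (rule finite_subset[of _ "{a}"]) auto
qed

lemma ncoeff_monom_times: "ncoeff (nmonom c a * f) x = c * ncoeff f (x - a)"
  for f :: "'a::comm_ring_1 novikov"
proof -
  have "nconv (ncoeff (nmonom c a)) (ncoeff f) x = (\<Sum>b\<in>{a}. ncoeff (nmonom c a) b * ncoeff f (x - b))"
    by (rule nconv_left) (auto simp: nmonom.rep_eq split: if_splits)
  then show ?thesis by (simp add: ncoeff_times nmonom.rep_eq)
qed

lemma novikov_invertible:
  fixes f :: "'a::field novikov"
  assumes "f \<noteq> 0" shows "\<exists>g. f * g = 1"
proof -
  obtain a0 where a0: "ncoeff f a0 \<noteq> 0" using assms novikov_eqI[of f 0] by (auto simp: ncoeff_zero)
  let ?A = "{a. a \<le> a0 \<and> ncoeff f a \<noteq> 0}"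
  define m where "m = Min ?A"
  have m: "ncoeff f m \<noteq> 0" using Min_in[of ?A] a0 ncoeff_finite unfolding m_def by blast
  have low: "m \<le> a" if "ncoeff f a \<noteq> 0" for a
  proof (cases "a \<le> a0")
    case True then show ?thesis using that unfolding m_def by (intro Min_le ncoeff_finite) auto
  next
    case False
    have "m \<le> a0" unfolding m_def using a0 by (intro Min_le ncoeff_finite) auto
    with False show ?thesis by simp
  qed
  define u where "u = nmonom (inverse (ncoeff f m)) (- m)"
  have "\<exists>g. (1 - (1 - u * f)) * g = 1"
  proof (rule novikov_one_minus_invertible)
    fix a assume "ncoeff (1 - u * f) a \<noteq> 0"
    then show "0 < a" using low[of "a + m"] m
      by (cases "a = 0") (auto simp: u_def ncoeff_diff ncoeff_one ncoeff_monom_times split: if_splits)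
  qed
  then obtain g where "u * f * g = 1" by auto
  then show ?thesis by (intro exI[of _ "u * g"]) (simp add: mult_ac)
qed

instantiation novikov :: (field) field
begin
definition inverse_novikov :: "'a novikov \<Rightarrow> 'a novikov" where
  "inverse_novikov f = (if f = 0 then 0 else SOME g. f * g = 1)"
definition divide_novikov :: "'a novikov \<Rightarrow> 'a novikov \<Rightarrow> 'a novikov" where
  "divide_novikov f g = f * inverse g"
instance
proof
  fix f g :: "'a novikov"
  show "inverse f * f = 1" if "f \<noteq> 0"
    using someI_ex[OF novikov_invertible[OF that]] that by (simp add: inverse_novikov_def mult.commute)
  show "f div g = f * inverse g" by (simp add: divide_novikov_def)
  show "inverse (0::'a novikov) = 0" by (simp add: inverse_novikov_def)
qed
end


section \<open>Submanifolds of Euclidean spaces\<close>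

text \<open>
  Manifolds are embedded submanifolds of Euclidean spaces, which by Whitney's theorem is no loss
  of generality. Vector-valued and tensorial objects (forms, almost complex structures) are given
  by multilinear maps on the ambient space at every point; only their values on tangent vectors
  carry meaning.
\<close>

primrec differentiable_times :: "nat \<Rightarrow> 'a::euclidean_space set \<Rightarrow> ('a \<Rightarrow> 'b::real_normed_vector) \<Rightarrow> bool" where
  "differentiable_times 0 U f \<longleftrightarrow> True"
| "differentiable_times (Suc k) U f \<longleftrightarrow> (\<forall>x\<in>U. f differentiable (at x)) \<and>
     (\<forall>v. differentiable_times k U (\<lambda>x. frechet_derivative f (at x) v))"

definition smooth_open :: "'a::euclidean_space set \<Rightarrow> ('a \<Rightarrow> 'b::real_normed_vector) \<Rightarrow> bool" where
  "smooth_open U f \<longleftrightarrow> (\<forall>k. differentiable_times k U f)"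

definition smooth_map_on :: "'a::euclidean_space set \<Rightarrow> ('a \<Rightarrow> 'b::real_normed_vector) \<Rightarrow> bool" where
  "smooth_map_on S f \<longleftrightarrow>
    (\<forall>x\<in>S. \<exists>U g. open U \<and> x \<in> U \<and> smooth_open U g \<and> (\<forall>y\<in>U \<inter> S. g y = f y))"

definition submanifold :: "nat \<Rightarrow> 'a::euclidean_space set \<Rightarrow> bool" where
  "submanifold d S \<longleftrightarrow> (\<forall>x\<in>S. \<exists>U V L (h :: 'a \<Rightarrow> 'a) k.
     open U \<and> x \<in> U \<and> open V \<and> smooth_open U h \<and> smooth_open V k \<and>
     h ` U = V \<and> k ` V = U \<and> (\<forall>y\<in>U. k (h y) = y) \<and> (\<forall>z\<in>V. h (k z) = z) \<and>
     subspace L \<and> dim L = d \<and> h ` (U \<inter> S) = V \<inter> L)"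

definition tangent :: "'a::euclidean_space set \<Rightarrow> 'a \<Rightarrow> 'a set" where
  "tangent S x = {v. \<exists>c :: real \<Rightarrow> 'a. smooth_map_on UNIV c \<and> range c \<subseteq> S \<and> c 0 = x \<and>
     (c has_vector_derivative v) (at 0)}"

text \<open>
  The differential of \<open>f\<close> on the tangent vector \<open>v\<close>. Derivatives within \<open>S\<close> are not unique on the
  ambient space, but they agree on vectors tangent to \<open>S\<close>.
\<close>

definition dmap :: "'a::euclidean_space set \<Rightarrow> ('a \<Rightarrow> 'b::real_normed_vector) \<Rightarrow> 'a \<Rightarrow> 'a \<Rightarrow> 'b" where
  "dmap S f x v = (THE w. \<forall>L. (f has_derivative L) (at x within S) \<longrightarrow> L v = w)"

definition smooth_bilinear :: "'a::euclidean_space set \<Rightarrow> ('a \<Rightarrow> 'a \<Rightarrow> 'a \<Rightarrow> real) \<Rightarrow> bool" where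
  "smooth_bilinear S g \<longleftrightarrow>
     (\<forall>x\<in>S. bilinear (g x)) \<and> (\<forall>v w. smooth_map_on S (\<lambda>x. g x v w))"

definition symplectic_form :: "'a::euclidean_space set \<Rightarrow> ('a \<Rightarrow> 'a \<Rightarrow> 'a \<Rightarrow> real) \<Rightarrow> bool" where
  "symplectic_form S w \<longleftrightarrow> smooth_bilinear S w \<and>
     (\<forall>x\<in>S. \<forall>u\<in>tangent S x. \<forall>v\<in>tangent S x. w x u v = - w x v u) \<and>
     (\<forall>x\<in>S. \<forall>u\<in>tangent S x. u \<noteq> 0 \<longrightarrow> (\<exists>v\<in>tangent S x. w x u v \<noteq> 0)) \<and>
     (\<forall>x\<in>S. \<forall>a\<in>tangent S x. \<forall>b\<in>tangent S x. \<forall>c\<in>tangent S x.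
        dmap S (\<lambda>y. w y b c) x a - dmap S (\<lambda>y. w y a c) x b + dmap S (\<lambda>y. w y a b) x c = 0)"

text \<open>
  \<open>T\<close> is the tangent bundle; it is an argument so that the notion also applies to manifolds
  with boundary.
\<close>

definition compatible_acs ::
  "'a::euclidean_space set \<Rightarrow> ('a \<Rightarrow> 'a set) \<Rightarrow> ('a \<Rightarrow> 'a \<Rightarrow> 'a \<Rightarrow> real) \<Rightarrow> ('a \<Rightarrow> 'a \<Rightarrow> 'a) \<Rightarrow> bool" where
  "compatible_acs S T w I \<longleftrightarrow>
     (\<forall>x\<in>S. linear (I x)) \<and> (\<forall>v. smooth_map_on S (\<lambda>x. I x v)) \<and>
     (\<forall>x\<in>S. \<forall>u\<in>T x. I x u \<in> T x \<and> I x (I x u) = - u \<and> (u \<noteq> 0 \<longrightarrow> 0 < w x u (I x u)) \<and>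
        (\<forall>v\<in>T x. w x (I x u) (I x v) = w x u v))"


section \<open>Symplectic C*-manifolds\<close>

record 'e cstar_mfd =
  pts :: "'e set"
  form :: "'e \<Rightarrow> 'e \<Rightarrow> 'e \<Rightarrow> real"
  acs :: "'e \<Rightarrow> 'e \<Rightarrow> 'e"
  act :: "complex \<Rightarrow> 'e \<Rightarrow> 'e"
  mom :: "'e \<Rightarrow> real"

abbreviation circ :: "'e cstar_mfd \<Rightarrow> real \<Rightarrow> 'e \<Rightarrow> 'e" where
  "circ M t \<equiv> act M (cis (2 * pi * t))"

abbreviation tan_at :: "'e::euclidean_space cstar_mfd \<Rightarrow> 'e \<Rightarrow> 'e set" where
  "tan_at M \<equiv> tangent (pts M)"

definition circ_field :: "'e::euclidean_space cstar_mfd \<Rightarrow> 'e \<Rightarrow> 'e" where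
  "circ_field M y = vector_derivative (\<lambda>t. circ M t y) (at 0)"

text \<open>The complex dimension of the manifold is the cardinality of the type \<open>'n\<close>.\<close>

definition symplectic_Cstar_manifold ::
  "'n::finite itself \<Rightarrow> 'e::euclidean_space cstar_mfd \<Rightarrow> bool" where
  "symplectic_Cstar_manifold _ M \<longleftrightarrow>
     submanifold (2 * CARD('n)) (pts M) \<and> pts M \<noteq> {} \<and> connected (pts M) \<and> \<not> compact (pts M) \<and>
     symplectic_form (pts M) (form M) \<and>
     compatible_acs (pts M) (tan_at M) (form M) (acs M) \<and>
     smooth_map_on ((- {0}) \<times> pts M) (\<lambda>(z, y). act M z y) \<and>
     (\<forall>y\<in>pts M. act M 1 y = y \<and> (\<forall>z. z \<noteq> 0 \<longrightarrow> act M z y \<in> pts M \<and>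
        (\<forall>z'. z' \<noteq> 0 \<longrightarrow> act M z' (act M z y) = act M (z' * z) y))) \<and>
     (\<forall>z. z \<noteq> 0 \<longrightarrow> (\<forall>y\<in>pts M. \<forall>\<zeta>. \<forall>v\<in>tan_at M y.
        dmap ((- {0}) \<times> pts M) (\<lambda>(z, y). act M z y) (z, y) (\<i> * \<zeta>, acs M y v) =
        acs M (act M z y) (dmap ((- {0}) \<times> pts M) (\<lambda>(z, y). act M z y) (z, y) (\<zeta>, v)))) \<and>
     smooth_map_on (pts M) (mom M) \<and>
     (\<forall>y\<in>pts M. \<forall>v\<in>tan_at M y. form M y v (circ_field M y) = dmap (pts M) (mom M) y v)"

definition normalised_moment_map :: "'e::euclidean_space cstar_mfd \<Rightarrow> bool" where
  "normalised_moment_map M \<longleftrightarrow>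
     (\<forall>C. compact C \<longrightarrow> compact {y \<in> pts M. mom M y \<in> C}) \<and>
     (\<forall>y\<in>pts M. 0 \<le> mom M y) \<and> (\<exists>y\<in>pts M. mom M y = 0)"


section \<open>Riemannian geometry for bounded geometry at infinity\<close>

definition riemannian ::
  "'a::euclidean_space set \<Rightarrow> ('a \<Rightarrow> 'a set) \<Rightarrow> ('a \<Rightarrow> 'a \<Rightarrow> 'a \<Rightarrow> real) \<Rightarrow> bool" where
  "riemannian S T g \<longleftrightarrow> smooth_bilinear S g \<and>
     (\<forall>x\<in>S. \<forall>u\<in>T x. (u \<noteq> 0 \<longrightarrow> 0 < g x u u) \<and> (\<forall>v\<in>T x. g x u v = g x v u))"

text \<open>\<open>\<sigma>\<close> parametrises an open part of \<open>S\<close> by an open subset \<open>V\<close> of the linear subspace \<open>L\<close>.\<close>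

definition local_param :: "'a::euclidean_space set \<Rightarrow> 'a set \<Rightarrow> 'a set \<Rightarrow> ('a \<Rightarrow> 'a) \<Rightarrow> bool" where
  "local_param S L V \<sigma> \<longleftrightarrow> subspace L \<and> openin (top_of_set L) V \<and> smooth_map_on V \<sigma> \<and>
     openin (top_of_set S) (\<sigma> ` V) \<and> (\<exists>\<rho>. homeomorphism V (\<sigma> ` V) \<sigma> \<rho>) \<and>
     (\<forall>x\<in>V. \<forall>v\<in>L. dmap V \<sigma> x v = 0 \<longrightarrow> v = 0)"

text \<open>
  \<open>\<Gamma>\<close> is the Christoffel tensor of the metric \<open>g\<close> in the parametrisation \<open>\<sigma>\<close>, characterised as the
  symmetric one that makes \<open>g\<close> parallel.
\<close>

definition christoffel :: "('a::euclidean_space \<Rightarrow> 'a \<Rightarrow> 'a \<Rightarrow> real) \<Rightarrow> 'a set \<Rightarrow> 'a set \<Rightarrow> ('a \<Rightarrow> 'a) \<Rightarrow>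
    ('a \<Rightarrow> 'a \<Rightarrow> 'a \<Rightarrow> 'a) \<Rightarrow> bool" where
  "christoffel g L V \<sigma> \<Gamma> \<longleftrightarrow>
     (let G = (\<lambda>x v w. g (\<sigma> x) (dmap V \<sigma> x v) (dmap V \<sigma> x w)) in
      (\<forall>x\<in>V. bilinear (\<Gamma> x)) \<and> (\<forall>v w. smooth_map_on V (\<lambda>x. \<Gamma> x v w)) \<and>
      (\<forall>x\<in>V. \<forall>u\<in>L. \<forall>v\<in>L. \<Gamma> x u v \<in> L \<and> \<Gamma> x u v = \<Gamma> x v u \<and>
         (\<forall>w\<in>L. dmap V (\<lambda>y. G y v w) x u = G x (\<Gamma> x u v) w + G x v (\<Gamma> x u w))))"

definition sectional_curvature_le ::
  "'a::euclidean_space set \<Rightarrow> ('a \<Rightarrow> 'a \<Rightarrow> 'a \<Rightarrow> real) \<Rightarrow> 'a \<Rightarrow> real \<Rightarrow> bool" where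
  "sectional_curvature_le S g p C \<longleftrightarrow>
     (\<forall>L V \<sigma> \<Gamma> x. local_param S L V \<sigma> \<and> christoffel g L V \<sigma> \<Gamma> \<and> x \<in> V \<and> \<sigma> x = p \<longrightarrow>
       (let G = (\<lambda>v w. g p (dmap V \<sigma> x v) (dmap V \<sigma> x w));
            Rm = (\<lambda>u v w. dmap V (\<lambda>y. \<Gamma> y v w) x u - dmap V (\<lambda>y. \<Gamma> y u w) x v
                    + \<Gamma> x u (\<Gamma> x v w) - \<Gamma> x v (\<Gamma> x u w)) in
        \<forall>u\<in>L. \<forall>v\<in>L. G (Rm u v v) u \<le> C * (G u u * G v v - (G u v)\<^sup>2)))"

definition geodesic_on ::
  "'a::euclidean_space set \<Rightarrow> ('a \<Rightarrow> 'a \<Rightarrow> 'a \<Rightarrow> real) \<Rightarrow> real set \<Rightarrow> (real \<Rightarrow> 'a) \<Rightarrow> bool" where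
  "geodesic_on S g J c \<longleftrightarrow> (\<forall>t\<in>J. \<exists>L V \<sigma> \<Gamma> x e.
     local_param S L V \<sigma> \<and> christoffel g L V \<sigma> \<Gamma> \<and> 0 < e \<and> smooth_open {t - e<..<t + e} x \<and>
     (\<forall>r\<in>{t - e<..<t + e}. x r \<in> V \<and> c r = \<sigma> (x r)) \<and>
     vector_derivative (\<lambda>r. vector_derivative x (at r)) (at t) +
       \<Gamma> (x t) (vector_derivative x (at t)) (vector_derivative x (at t)) = 0)"

text \<open>The exponential map at \<open>p\<close> is a diffeomorphism from the open ball of radius \<open>r\<close> onto its image.\<close>

definition injectivity_radius_ge ::
  "'a::euclidean_space set \<Rightarrow> ('a \<Rightarrow> 'a \<Rightarrow> 'a \<Rightarrow> real) \<Rightarrow> 'a \<Rightarrow> real \<Rightarrow> bool" where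
  "injectivity_radius_ge S g p r \<longleftrightarrow>
     (let D = {v \<in> tangent S p. g p v v < r\<^sup>2} in
      \<exists>ex. inj_on ex D \<and> smooth_map_on D ex \<and>
        (\<forall>v\<in>D. \<forall>w\<in>tangent S p. dmap D ex v w = 0 \<longrightarrow> w = 0) \<and>
        (\<forall>v\<in>D. \<exists>J c. open J \<and> connected J \<and> {0..1} \<subseteq> J \<and> geodesic_on S g J c \<and>
           c 0 = p \<and> (c has_vector_derivative v) (at 0) \<and> c 1 = ex v))"


section \<open>Convex base\<close>

record ('e, 'f) convex_base =
  core :: "'e set"
  link :: "'f set"
  cform :: "'f \<Rightarrow> 'f \<Rightarrow> real"
  rad0 :: real
  bacs :: "'f \<times> real \<Rightarrow> 'f \<times> real \<Rightarrow> 'f \<times> real"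
  bmap :: "'e \<Rightarrow> 'f \<times> real"
  bfun :: "'f \<Rightarrow> real"

definition d_one_form ::
  "'a::euclidean_space set \<Rightarrow> ('a \<Rightarrow> 'a \<Rightarrow> real) \<Rightarrow> 'a \<Rightarrow> 'a \<Rightarrow> 'a \<Rightarrow> real" where
  "d_one_form S a x v w = dmap S (\<lambda>y. a y w) x v - dmap S (\<lambda>y. a y v) x w"

definition closed_contact_manifold :: "'a::euclidean_space set \<Rightarrow> ('a \<Rightarrow> 'a \<Rightarrow> real) \<Rightarrow> bool" where
  "closed_contact_manifold S a \<longleftrightarrow> compact S \<and> (\<exists>d. submanifold d S) \<and>
     (\<forall>x\<in>S. linear (a x)) \<and> (\<forall>v. smooth_map_on S (\<lambda>x. a x v)) \<and>
     (\<forall>x\<in>S. (\<exists>v\<in>tangent S x. a x v \<noteq> 0) \<and>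
        (\<forall>v\<in>tangent S x. a x v = 0 \<and> v \<noteq> 0 \<longrightarrow>
           (\<exists>w\<in>tangent S x. a x w = 0 \<and> d_one_form S a x v w \<noteq> 0)))"

definition reeb :: "'a::euclidean_space set \<Rightarrow> ('a \<Rightarrow> 'a \<Rightarrow> real) \<Rightarrow> 'a \<Rightarrow> 'a" where
  "reeb S a x = (THE v. v \<in> tangent S x \<and> a x v = 1 \<and> (\<forall>w\<in>tangent S x. d_one_form S a x v w = 0))"

definition base_pts :: "('e, 'f) convex_base \<Rightarrow> ('f \<times> real) set" where
  "base_pts B = link B \<times> {rad0 B..}"

definition base_tan :: "('e, 'f::euclidean_space) convex_base \<Rightarrow> 'f \<times> real \<Rightarrow> ('f \<times> real) set" where
  "base_tan B q = tangent (link B) (fst q) \<times> UNIV"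

text \<open>This is \<open>d(R \<alpha>) = dR \<and> \<alpha> + R d\<alpha>\<close>.\<close>

definition base_form ::
  "('e, 'f::euclidean_space) convex_base \<Rightarrow> 'f \<times> real \<Rightarrow> 'f \<times> real \<Rightarrow> 'f \<times> real \<Rightarrow> real" where
  "base_form B q u v =
     snd u * cform B (fst q) (fst v) - snd v * cform B (fst q) (fst u)
     + snd q * d_one_form (link B) (cform B) (fst q) (fst u) (fst v)"

text \<open>
  A complete metric which is uniformly comparable to the pair of symplectic form and almost complex
  structure and which, near infinity, has sectional curvature bounded above and injectivity radius
  bounded below. Completeness: paths of bounded length starting at the boundary stay in a
  compact part.
\<close>

definition geometrically_bounded_at_infinity :: "('e, 'f::euclidean_space) convex_base \<Rightarrow> bool" where
  "geometrically_bounded_at_infinity B \<longleftrightarrow>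
     (\<exists>g a b C r R1. riemannian (base_pts B) (base_tan B) g \<and> 0 < a \<and> 0 < r \<and>
       (\<forall>q\<in>base_pts B. \<forall>u\<in>base_tan B q. a * g q u u \<le> base_form B q u (bacs B q u) \<and>
          (\<forall>v\<in>base_tan B q. \<bar>base_form B q u v\<bar> \<le> b * sqrt (g q u u) * sqrt (g q v v))) \<and>
       (\<forall>l. \<exists>R2. \<forall>c. smooth_map_on {0..1} c \<and> c ` {0..1} \<subseteq> base_pts B \<and> snd (c 0) = rad0 B \<and>
          integral {0..1} (\<lambda>t. let v = vector_derivative c (at t within {0..1})
             in sqrt (g (c t) v v)) \<le> l
          \<longrightarrow> snd (c 1) \<le> R2) \<and>
       (\<forall>q\<in>base_pts B. R1 \<le> snd q \<and> rad0 B < snd q \<longrightarrow>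
          sectional_curvature_le (link B \<times> {rad0 B<..}) g q C \<and>
          injectivity_radius_ge (link B \<times> {rad0 B<..}) g q r))"

definition rel_interior_in :: "'a::topological_space set \<Rightarrow> 'a set \<Rightarrow> 'a set" where
  "rel_interior_in S A = {x \<in> A. \<exists>U. open U \<and> x \<in> U \<and> U \<inter> S \<subseteq> A}"

definition compact_subdomain :: "'a::euclidean_space set \<Rightarrow> 'a set \<Rightarrow> bool" where
  "compact_subdomain S A \<longleftrightarrow> A \<subseteq> S \<and> compact A \<and>
     (\<forall>x\<in>A. \<exists>U (\<rho> :: 'a \<Rightarrow> real). open U \<and> x \<in> U \<and> smooth_open U \<rho> \<and>
        (\<exists>v\<in>tangent S x. dmap S \<rho> x v \<noteq> 0) \<and> A \<inter> U = {y \<in> S \<inter> U. \<rho> y \<le> 0})"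

definition outer_part :: "'e::euclidean_space cstar_mfd \<Rightarrow> ('e, 'f) convex_base \<Rightarrow> 'e set" where
  "outer_part M B = pts M - rel_interior_in (pts M) (core B)"

definition over_convex_base ::
  "'e::euclidean_space cstar_mfd \<Rightarrow> ('e, 'f::euclidean_space) convex_base \<Rightarrow> bool" where
  "over_convex_base M B \<longleftrightarrow>
     compact_subdomain (pts M) (core B) \<and> closed_contact_manifold (link B) (cform B) \<and> 0 < rad0 B \<and>
     compatible_acs (base_pts B) (base_tan B) (base_form B) (bacs B) \<and>
     (\<forall>q\<in>base_pts B. \<forall>u\<in>base_tan B q. snd u = snd q * cform B (fst q) (fst (bacs B q u))) \<and>
     geometrically_bounded_at_infinity B \<and>
     smooth_map_on (outer_part M B) (bmap B) \<and> bmap B ` outer_part M B \<subseteq> base_pts B \<and>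
     (\<forall>C. compact C \<and> C \<subseteq> base_pts B \<longrightarrow> compact {y \<in> outer_part M B. bmap B y \<in> C}) \<and>
     (\<forall>y\<in>outer_part M B. \<forall>v\<in>tan_at M y.
        dmap (outer_part M B) (bmap B) y (acs M y v) =
        bacs B (bmap B y) (dmap (outer_part M B) (bmap B) y v)) \<and>
     smooth_map_on (link B) (bfun B) \<and>
     (\<forall>x\<in>link B. 0 < bfun B x \<and> dmap (link B) (bfun B) x (reeb (link B) (cform B) x) = 0) \<and>
     (\<forall>y\<in>outer_part M B.
        let q = bmap B y; w = dmap (outer_part M B) (bmap B) y (circ_field M y) in
        w \<in> base_tan B q \<and>
        (\<forall>u\<in>base_tan B q. base_form B q u w =
           snd q * dmap (link B) (bfun B) (fst q) (fst u) + bfun B (fst q) * snd u))"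


section \<open>Weights, Chern numbers, monotonicity\<close>

definition cframe :: "'e::euclidean_space cstar_mfd \<Rightarrow> 'e \<Rightarrow> (complex^'n \<Rightarrow> 'e) \<Rightarrow> bool" where
  "cframe M x E \<longleftrightarrow> linear E \<and> bij_betw E UNIV (tan_at M x) \<and> (\<forall>v. E (\<i> *s v) = acs M x (E v))"

definition weight_sum :: "'n::finite itself \<Rightarrow> 'e::euclidean_space cstar_mfd \<Rightarrow> 'e \<Rightarrow> int \<Rightarrow> bool" where
  "weight_sum _ M x \<mu> \<longleftrightarrow> (\<exists>(E :: complex^'n \<Rightarrow> 'e) w. cframe M x E \<and> \<mu> = (\<Sum>j\<in>UNIV. w j) \<and>
     (\<forall>j t. dmap (pts M) (circ M t) x (E (axis j 1)) =
            E (axis j (cis (2 * pi * of_int (w j) * t)))))"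

definition disc_in :: "'e::euclidean_space cstar_mfd \<Rightarrow> (complex \<Rightarrow> 'e) \<Rightarrow> bool" where
  "disc_in M c \<longleftrightarrow> smooth_map_on (cball 0 1) c \<and> c ` cball 0 1 \<subseteq> pts M"

text \<open>
  Classes in the second homotopy group are represented by smooth maps of the closed unit disc which
  are constant on the boundary circle.
\<close>

definition sphere_in :: "'e::euclidean_space cstar_mfd \<Rightarrow> (complex \<Rightarrow> 'e) \<Rightarrow> bool" where
  "sphere_in M c \<longleftrightarrow> disc_in M c \<and> (\<exists>p. \<forall>z\<in>sphere 0 1. c z = p)"

text \<open>\<open>\<theta>\<close> is a continuous choice of argument for the nowhere vanishing complex function \<open>f\<close>.\<close>

definition arg_lift :: "real set \<Rightarrow> (real \<Rightarrow> complex) \<Rightarrow> (real \<Rightarrow> real) \<Rightarrow> bool" where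
  "arg_lift T f \<theta> \<longleftrightarrow> continuous_on T \<theta> \<and>
     (\<forall>t\<in>T. f t \<noteq> 0 \<and> f t = of_real (cmod (f t)) * cis (\<theta> t))"

text \<open>
  A frame \<open>E\<close> over the disc is compared on the boundary with its value at \<open>1\<close>. A section which is
  constant on the boundary has coefficients winding opposite to the frame, whence the sign.
\<close>

definition chern_number :: "'n::finite itself \<Rightarrow> 'e::euclidean_space cstar_mfd \<Rightarrow> (complex \<Rightarrow> 'e) \<Rightarrow> int" where
  "chern_number _ M c = (THE k. \<exists>(E :: complex \<Rightarrow> complex^'n \<Rightarrow> 'e) \<theta>.
     (\<forall>z\<in>cball 0 1. cframe M (c z) (E z)) \<and> (\<forall>v. continuous_on (cball 0 1) (\<lambda>z. E z v)) \<and>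
     arg_lift {0..1} (\<lambda>t. det (matrix (inv_into UNIV (E 1) \<circ> E (cis (2 * pi * t))))) \<theta> \<and>
     \<theta> 1 - \<theta> 0 = - 2 * pi * of_int k)"

definition symplectic_area :: "'e::euclidean_space cstar_mfd \<Rightarrow> (complex \<Rightarrow> 'e) \<Rightarrow> real" where
  "symplectic_area M c = integral (cball 0 1)
     (\<lambda>z. form M (c z) (dmap (cball 0 1) c z 1) (dmap (cball 0 1) c z \<i>))"

definition weak_plus_monotone :: "'n::finite itself \<Rightarrow> 'e::euclidean_space cstar_mfd \<Rightarrow> bool" where
  "weak_plus_monotone TN M \<longleftrightarrow>
     (\<forall>c. sphere_in M c \<longrightarrow> chern_number TN M c = 0) \<or>
     (\<forall>c. sphere_in M c \<longrightarrow> symplectic_area M c = 0) \<or>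
     (\<exists>k>0. \<forall>c. sphere_in M c \<longrightarrow> of_int (chern_number TN M c) = k * symplectic_area M c) \<or>
     (\<forall>c. sphere_in M c \<and> 0 < chern_number TN M c \<longrightarrow> int CARD('n) - 1 \<le> chern_number TN M c)"

text \<open>
  Gradings take values in the integers modulo \<open>2 N\<close>, where all Chern numbers are divisible by \<open>N\<close>.
  Thus \<open>N = 0\<close> gives an integer grading when all Chern numbers vanish, and \<open>N = 1\<close>, which is always
  permitted, gives a grading modulo 2.
\<close>

definition grading_level :: "'n::finite itself \<Rightarrow> 'e::euclidean_space cstar_mfd \<Rightarrow> nat \<Rightarrow> bool" where
  "grading_level TN M N \<longleftrightarrow> (\<forall>c. sphere_in M c \<longrightarrow> int N dvd chern_number TN M c)"

definition same_degree :: "nat \<Rightarrow> int \<Rightarrow> int \<Rightarrow> bool" where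
  "same_degree N k l \<longleftrightarrow> 2 * int N dvd k - l"


section \<open>Hamiltonian orbits and their degrees\<close>

definition generic_slope :: "'e cstar_mfd \<Rightarrow> real \<Rightarrow> bool" where
  "generic_slope M l \<longleftrightarrow> 0 < l \<and>
     \<not> (\<exists>y\<in>pts M. circ M l y = y \<and> (\<exists>t. circ M t y \<noteq> y))"

definition ham_field :: "'e::euclidean_space cstar_mfd \<Rightarrow> ('e \<Rightarrow> real) \<Rightarrow> 'e \<Rightarrow> 'e" where
  "ham_field M F y =
     (THE v. v \<in> tan_at M y \<and> (\<forall>w\<in>tan_at M y. form M y w v = dmap (pts M) F y w))"

definition capping :: "'e::euclidean_space cstar_mfd \<Rightarrow> (real \<Rightarrow> 'e) \<Rightarrow> (complex \<Rightarrow> 'e) \<Rightarrow> bool" where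
  "capping M x c \<longleftrightarrow> disc_in M c \<and> (\<forall>t. c (cis (2 * pi * t)) = x t)"

definition orbits :: "'e::euclidean_space cstar_mfd \<Rightarrow> (real \<Rightarrow> 'e \<Rightarrow> real) \<Rightarrow> (real \<Rightarrow> 'e) set" where
  "orbits M F = {x. smooth_map_on UNIV x \<and> (\<exists>c. capping M x c) \<and>
     (\<forall>t. x (t + 1) = x t \<and> x t \<in> pts M \<and>
        (x has_vector_derivative ham_field M (F t) (x t)) (at t))}"

definition lin_flow ::
  "'e::euclidean_space cstar_mfd \<Rightarrow> (real \<Rightarrow> 'e \<Rightarrow> real) \<Rightarrow> (real \<Rightarrow> 'e) \<Rightarrow> real \<Rightarrow> 'e \<Rightarrow> 'e" where
  "lin_flow M F x t v = (THE u. \<exists>w :: real \<Rightarrow> real \<Rightarrow> 'e.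
     smooth_map_on (UNIV \<times> {0..1}) (\<lambda>(e, t). w e t) \<and>
     (\<forall>e. \<forall>t\<in>{0..1}. w e t \<in> pts M \<and>
        (w e has_vector_derivative ham_field M (F t) (w e t)) (at t within {0..1})) \<and>
     (\<forall>t\<in>{0..1}. w 0 t = x t) \<and>
     ((\<lambda>e. w e 0) has_vector_derivative v) (at 0) \<and>
     ((\<lambda>e. w e t) has_vector_derivative u) (at 0))"

definition nondegenerate_orbit ::
  "'e::euclidean_space cstar_mfd \<Rightarrow> (real \<Rightarrow> 'e \<Rightarrow> real) \<Rightarrow> (real \<Rightarrow> 'e) \<Rightarrow> bool" where
  "nondegenerate_orbit M F x \<longleftrightarrow> (\<forall>v\<in>tan_at M (x 0). lin_flow M F x 1 v = v \<longrightarrow> v = 0)"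

definition std_form :: "complex^'n \<Rightarrow> complex^'n \<Rightarrow> real" where
  "std_form v w = (\<Sum>j\<in>UNIV. Im (cnj (v $ j) * w $ j))"

definition complex_part :: "(complex^'n \<Rightarrow> complex^'n) \<Rightarrow> complex^'n \<Rightarrow> complex^'n" where
  "complex_part A v = (1 / 2) *s (A v - \<i> *s A (\<i> *s v))"

definition hyperbolic_end :: "'n \<Rightarrow> complex^'n \<Rightarrow> complex^'n" where
  "hyperbolic_end j v =
     (\<chi> i. if i = j then Complex (2 * Re (v $ i)) (Im (v $ i) / 2) else - v $ i)"

text \<open>
  The linearised flow in a unitary frame over a capping disc is a path of symplectic matrices on
  \<open>{0..1}\<close>. It is extended over \<open>{1..2}\<close>, through matrices without eigenvalue 1, to one of two
  standard end points, and the Conley-Zehnder index \<open>m\<close> is the total winding of the squared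
  determinant. The complex linear part of a symplectic matrix has the same determinant, up to a
  positive factor, as the unitary part of its polar decomposition.
\<close>

definition conley_zehnder :: "'n::finite itself \<Rightarrow> 'e::euclidean_space cstar_mfd \<Rightarrow>
    (real \<Rightarrow> 'e \<Rightarrow> real) \<Rightarrow> (real \<Rightarrow> 'e) \<Rightarrow> (complex \<Rightarrow> 'e) \<Rightarrow> int \<Rightarrow> bool" where
  "conley_zehnder _ M F x c m \<longleftrightarrow>
     (\<exists>(E :: complex \<Rightarrow> complex^'n \<Rightarrow> 'e) (A :: real \<Rightarrow> complex^'n \<Rightarrow> complex^'n) \<theta>.
       (\<forall>z\<in>cball 0 1. cframe M (c z) (E z) \<and>
          (\<forall>v w. form M (c z) (E z v) (E z w) = std_form v w)) \<and>
       (\<forall>v. continuous_on (cball 0 1) (\<lambda>z. E z v)) \<and>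
       (\<forall>t\<in>{0..1}. \<forall>v. A t v = inv_into UNIV (E (cis (2 * pi * t))) (lin_flow M F x t (E 1 v))) \<and>
       (\<forall>t\<in>{0..2}. linear (A t) \<and> (\<forall>v w. std_form (A t v) (A t w) = std_form v w)) \<and>
       (\<forall>v. continuous_on {0..2} (\<lambda>t. A t v)) \<and>
       (\<forall>t\<in>{1..2}. \<forall>v. A t v = v \<longrightarrow> v = 0) \<and>
       (A 2 = uminus \<or> (\<exists>j. A 2 = hyperbolic_end j)) \<and>
       arg_lift {0..2} (\<lambda>t. det (matrix (complex_part (A t)))) \<theta> \<and>
       \<theta> 2 - \<theta> 0 = pi * of_int m)"

text \<open>
  Degree \<open>n - CZ\<close>, so that for a small autonomous Morse function the degree is the Morse index.
\<close>

definition orbit_degree :: "'n::finite itself \<Rightarrow> 'e::euclidean_space cstar_mfd \<Rightarrow> nat \<Rightarrow>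
    (real \<Rightarrow> 'e \<Rightarrow> real) \<Rightarrow> (real \<Rightarrow> 'e) \<Rightarrow> int \<Rightarrow> bool" where
  "orbit_degree TN M N F x k \<longleftrightarrow>
     (\<exists>c m. capping M x c \<and> conley_zehnder TN M F x c m \<and> same_degree N k (int CARD('n) - m))"


section \<open>Floer trajectories\<close>

definition ds :: "(real \<Rightarrow> real \<Rightarrow> 'e::real_normed_vector) \<Rightarrow> real \<Rightarrow> real \<Rightarrow> 'e" where
  "ds u s t = vector_derivative (\<lambda>s. u s t) (at s)"

definition dt :: "(real \<Rightarrow> real \<Rightarrow> 'e::real_normed_vector) \<Rightarrow> real \<Rightarrow> real \<Rightarrow> 'e" where
  "dt u s t = vector_derivative (u s) (at t)"

type_synonym 'e ham_family = "real \<Rightarrow> real \<Rightarrow> 'e \<Rightarrow> real"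
type_synonym 'e acs_family = "real \<Rightarrow> real \<Rightarrow> 'e \<Rightarrow> 'e \<Rightarrow> 'e"

definition floer_op :: "'e::euclidean_space cstar_mfd \<Rightarrow> 'e ham_family \<Rightarrow> 'e acs_family \<Rightarrow>
    (real \<Rightarrow> real \<Rightarrow> 'e) \<Rightarrow> real \<Rightarrow> real \<Rightarrow> 'e" where
  "floer_op M F J u s t = ds u s t + J s t (u s t) (dt u s t - ham_field M (F s t) (u s t))"

definition trajectories :: "'e::euclidean_space cstar_mfd \<Rightarrow> 'e ham_family \<Rightarrow> 'e acs_family \<Rightarrow>
    (real \<Rightarrow> 'e) \<Rightarrow> (real \<Rightarrow> 'e) \<Rightarrow> (real \<Rightarrow> real \<Rightarrow> 'e) set" where
  "trajectories M F J x y = {u. smooth_map_on UNIV (\<lambda>(s, t). u s t) \<and>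
     (\<forall>s t. u s (t + 1) = u s t \<and> u s t \<in> pts M \<and> floer_op M F J u s t = 0) \<and>
     uniform_limit UNIV u x at_bot \<and> uniform_limit UNIV u y at_top}"

text \<open>
  The topological energy. Its second term is the total derivative along \<open>u\<close>; for a Hamiltonian
  independent of \<open>s\<close> the integrand is \<open>\<omega>(\<partial>\<^sub>s u, J \<partial>\<^sub>s u)\<close>.
\<close>

definition energy :: "'e::euclidean_space cstar_mfd \<Rightarrow> 'e ham_family \<Rightarrow> (real \<Rightarrow> real \<Rightarrow> 'e) \<Rightarrow> real" where
  "energy M F u = integral (UNIV \<times> {0..1}) (\<lambda>(s, t). form M (u s t) (ds u s t) (dt u s t)
     - vector_derivative (\<lambda>s. F s t (u s t)) (at s))"

text \<open>
  The Floer operator vanishes on \<open>u\<close>, so its derivative along a variation of \<open>u\<close> depends only on the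
  variation field \<open>\<xi>\<close> and is tangent to the manifold; no connection is needed.
\<close>

definition linearised_floer :: "'e::euclidean_space cstar_mfd \<Rightarrow> 'e ham_family \<Rightarrow> 'e acs_family \<Rightarrow>
    (real \<Rightarrow> real \<Rightarrow> 'e) \<Rightarrow> (real \<Rightarrow> real \<Rightarrow> 'e) \<Rightarrow> (real \<Rightarrow> real \<Rightarrow> 'e) \<Rightarrow> bool" where
  "linearised_floer M F J u \<xi> \<eta> \<longleftrightarrow> (\<exists>w :: real \<Rightarrow> real \<Rightarrow> real \<Rightarrow> 'e.
     smooth_map_on UNIV (\<lambda>(e, s, t). w e s t) \<and> w 0 = u \<and>
     (\<forall>e s t. w e s t \<in> pts M \<and> w e s (t + 1) = w e s t) \<and>
     (\<forall>s t. ((\<lambda>e. w e s t) has_vector_derivative \<xi> s t) (at 0) \<and>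
            ((\<lambda>e. floer_op M F J (w e) s t) has_vector_derivative \<eta> s t) (at 0)))"

text \<open>
  Surjectivity of the linearised operator. Compactly supported right hand sides are dense and the
  range is closed; solutions which tend to \<open>0\<close> at the ends decay exponentially because the
  asymptotic orbits are non-degenerate. So smooth sections suffice.
\<close>

definition regular_trajectory :: "'e::euclidean_space cstar_mfd \<Rightarrow> 'e ham_family \<Rightarrow> 'e acs_family \<Rightarrow>
    (real \<Rightarrow> real \<Rightarrow> 'e) \<Rightarrow> bool" where
  "regular_trajectory M F J u \<longleftrightarrow> (\<forall>\<eta>. smooth_map_on UNIV (\<lambda>(s, t). \<eta> s t) \<and>
     (\<forall>s t. \<eta> s (t + 1) = \<eta> s t \<and> \<eta> s t \<in> tan_at M (u s t)) \<and>
     (\<exists>a. \<forall>s t. a < \<bar>s\<bar> \<longrightarrow> \<eta> s t = 0) \<longrightarrow>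
     (\<exists>\<xi>. linearised_floer M F J u \<xi> \<eta> \<and>
        uniform_limit UNIV \<xi> (\<lambda>_. 0) at_bot \<and> uniform_limit UNIV \<xi> (\<lambda>_. 0) at_top))"

text \<open>
  A solution is isolated in a set of solutions modulo the identifications \<open>C\<close>, in the uniform
  topology.
\<close>

definition isolated_up_to ::
  "(real \<Rightarrow> real \<Rightarrow> 'e::metric_space) set \<Rightarrow> (real \<Rightarrow> real \<Rightarrow> 'e) set \<Rightarrow> (real \<Rightarrow> real \<Rightarrow> 'e) \<Rightarrow> bool" where
  "isolated_up_to X C u \<longleftrightarrow> (\<exists>\<delta>>0. \<forall>v\<in>X. (\<forall>s t. dist (u s t) (v s t) < \<delta>) \<longrightarrow> v \<in> C)"


section \<open>Hamiltonian Floer cohomology\<close>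

text \<open>
  A Floer datum consists of a time-dependent Hamiltonian, a time-dependent almost complex structure
  and orientation signs for the rigid Floer trajectories modulo translation. Orientations of
  determinant lines are not constructed: coherence of the signs enters only through the requirement,
  in \<open>floer_part\<close> and \<open>seidel_part\<close> below, that the differentials and chain maps they define fit
  together to a persistence module with Seidel isomorphisms.
\<close>

record 'e floer_datum =
  fham :: "real \<Rightarrow> 'e \<Rightarrow> real"
  facs :: "real \<Rightarrow> 'e \<Rightarrow> 'e \<Rightarrow> 'e"
  fsgn :: "(real \<Rightarrow> real \<Rightarrow> 'e) set \<Rightarrow> int"

definition translates :: "(real \<Rightarrow> real \<Rightarrow> 'e) \<Rightarrow> (real \<Rightarrow> real \<Rightarrow> 'e) set" where
  "translates u = range (\<lambda>a s t. u (s + a) t)"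

abbreviation datum_trajectories :: "'e::euclidean_space cstar_mfd \<Rightarrow> 'e floer_datum \<Rightarrow>
    (real \<Rightarrow> 'e) \<Rightarrow> (real \<Rightarrow> 'e) \<Rightarrow> (real \<Rightarrow> real \<Rightarrow> 'e) set" where
  "datum_trajectories M D \<equiv> trajectories M (\<lambda>_. fham D) (\<lambda>_. facs D)"

definition rigid_lines :: "'e::euclidean_space cstar_mfd \<Rightarrow> 'e floer_datum \<Rightarrow>
    (real \<Rightarrow> 'e) \<Rightarrow> (real \<Rightarrow> 'e) \<Rightarrow> (real \<Rightarrow> real \<Rightarrow> 'e) set set" where
  "rigid_lines M D x y = {translates u | u. u \<in> datum_trajectories M D x y \<and>
     (\<exists>s t. ds u s t \<noteq> 0) \<and> isolated_up_to (datum_trajectories M D x y) (translates u) u}"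

definition line_energy ::
  "'e::euclidean_space cstar_mfd \<Rightarrow> 'e floer_datum \<Rightarrow> (real \<Rightarrow> real \<Rightarrow> 'e) set \<Rightarrow> real" where
  "line_energy M D C = energy M (\<lambda>_. fham D) (SOME u. u \<in> C)"

definition floer_datum_of_slope :: "'e::euclidean_space cstar_mfd \<Rightarrow> real \<Rightarrow> 'e floer_datum \<Rightarrow> bool" where
  "floer_datum_of_slope M l D \<longleftrightarrow>
     smooth_map_on (UNIV \<times> pts M) (\<lambda>(t, y). fham D t y) \<and>
     (\<forall>v. smooth_map_on (UNIV \<times> pts M) (\<lambda>(t, y). facs D t y v)) \<and>
     (\<forall>t. \<forall>y\<in>pts M. fham D (t + 1) y = fham D t y \<and> facs D (t + 1) y = facs D t y) \<and>
     (\<forall>t. compatible_acs (pts M) (tan_at M) (form M) (facs D t)) \<and>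
     (\<exists>C b. compact C \<and> (\<forall>t. \<forall>y\<in>pts M - C. fham D t y = l * mom M y + b \<and>
        (\<forall>v\<in>tan_at M y. facs D t y v = acs M y v))) \<and>
     finite (orbits M (fham D)) \<and> (\<forall>x\<in>orbits M (fham D). nondegenerate_orbit M (fham D) x) \<and>
     (\<forall>x\<in>orbits M (fham D). \<forall>y\<in>orbits M (fham D).
        (\<forall>u\<in>datum_trajectories M D x y. regular_trajectory M (\<lambda>_. fham D) (\<lambda>_. facs D) u) \<and>
        (\<forall>e. finite {C \<in> rigid_lines M D x y. line_energy M D C \<le> e}) \<and>
        (\<forall>C\<in>rigid_lines M D x y. fsgn D C \<in> {1, -1}))"

text \<open>
  Cochains are functions of the 1-orbits. A trajectory from \<open>x\<close> (at \<open>s = -\<infinity>\<close>) to \<open>y\<close> (at \<open>s = \<infinity>\<close>)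
  contributes \<open>\<plusminus> T\<^sup>E x\<close> to the differential of \<open>y\<close>.
\<close>

definition floer_cochains :: "'e::euclidean_space cstar_mfd \<Rightarrow> 'e floer_datum \<Rightarrow>
    ((real \<Rightarrow> 'e) \<Rightarrow> 'b::field novikov) set" where
  "floer_cochains M D = {z. \<forall>x. x \<notin> orbits M (fham D) \<longrightarrow> z x = 0}"

definition floer_diff :: "'e::euclidean_space cstar_mfd \<Rightarrow> 'e floer_datum \<Rightarrow>
    ((real \<Rightarrow> 'e) \<Rightarrow> 'b::field novikov) \<Rightarrow> (real \<Rightarrow> 'e) \<Rightarrow> 'b novikov" where
  "floer_diff M D z x = (if x \<in> orbits M (fham D) then
     (\<Sum>y\<in>orbits M (fham D).
        Novikov (\<lambda>e. \<Sum>C\<in>{C \<in> rigid_lines M D x y. line_energy M D C = e}. of_int (fsgn D C)) * z y)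
     else 0)"

definition floer_cocycles :: "'e::euclidean_space cstar_mfd \<Rightarrow> 'e floer_datum \<Rightarrow>
    ((real \<Rightarrow> 'e) \<Rightarrow> 'b::field novikov) set" where
  "floer_cocycles M D = {z \<in> floer_cochains M D. floer_diff M D z = (\<lambda>_. 0)}"

definition floer_coboundaries :: "'e::euclidean_space cstar_mfd \<Rightarrow> 'e floer_datum \<Rightarrow>
    ((real \<Rightarrow> 'e) \<Rightarrow> 'b::field novikov) set" where
  "floer_coboundaries M D = floer_diff M D ` floer_cochains M D"

definition floer_homogeneous :: "'n::finite itself \<Rightarrow> 'e::euclidean_space cstar_mfd \<Rightarrow> nat \<Rightarrow>
    'e floer_datum \<Rightarrow> int \<Rightarrow> ((real \<Rightarrow> 'e) \<Rightarrow> 'b::field novikov) set" where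
  "floer_homogeneous TN M N D k =
     {z. \<forall>x. z x \<noteq> 0 \<longrightarrow> orbit_degree TN M N (fham D) x k}"


section \<open>Continuation and Seidel maps\<close>

record 'e floer_homotopy =
  hham :: "'e ham_family"
  hacs :: "'e acs_family"
  hsgn :: "(real \<Rightarrow> real \<Rightarrow> 'e) \<Rightarrow> int"

definition rigid_solutions :: "'e::euclidean_space cstar_mfd \<Rightarrow> 'e floer_homotopy \<Rightarrow>
    (real \<Rightarrow> 'e) \<Rightarrow> (real \<Rightarrow> 'e) \<Rightarrow> (real \<Rightarrow> real \<Rightarrow> 'e) set" where
  "rigid_solutions M K x y = {u \<in> trajectories M (hham K) (hacs K) x y.
     isolated_up_to (trajectories M (hham K) (hacs K) x y) {u} u}"

text \<open>
  \<open>K\<close> is a homotopy from the datum \<open>D1\<close> at \<open>s = -\<infinity>\<close> to the datum \<open>D2\<close> at \<open>s = \<infinity>\<close>, monotone at infinity;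
  it induces a map from the cochains of \<open>D2\<close> to those of \<open>D1\<close>.
\<close>

definition floer_homotopy_between :: "'e::euclidean_space cstar_mfd \<Rightarrow> 'e floer_datum \<Rightarrow>
    'e floer_datum \<Rightarrow> 'e floer_homotopy \<Rightarrow> bool" where
  "floer_homotopy_between M D1 D2 K \<longleftrightarrow>
     smooth_map_on (UNIV \<times> UNIV \<times> pts M) (\<lambda>(s, t, y). hham K s t y) \<and>
     (\<forall>v. smooth_map_on (UNIV \<times> UNIV \<times> pts M) (\<lambda>(s, t, y). hacs K s t y v)) \<and>
     (\<forall>s t. \<forall>y\<in>pts M. hham K s (t + 1) y = hham K s t y \<and> hacs K s (t + 1) y = hacs K s t y) \<and>
     (\<forall>s t. compatible_acs (pts M) (tan_at M) (form M) (hacs K s t)) \<and>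
     (\<exists>a. \<forall>s t. \<forall>y\<in>pts M.
        (s \<le> - a \<longrightarrow> hham K s t y = fham D1 t y \<and> (\<forall>v\<in>tan_at M y. hacs K s t y v = facs D1 t y v)) \<and>
        (a \<le> s \<longrightarrow> hham K s t y = fham D2 t y \<and> (\<forall>v\<in>tan_at M y. hacs K s t y v = facs D2 t y v))) \<and>
     (\<exists>C h b. compact C \<and> antimono h \<and> (\<forall>s t. \<forall>y\<in>pts M - C. hham K s t y = h s * mom M y + b s \<and>
        (\<forall>v\<in>tan_at M y. hacs K s t y v = acs M y v))) \<and>
     (\<forall>x\<in>orbits M (fham D1). \<forall>y\<in>orbits M (fham D2).
        (\<forall>u\<in>trajectories M (hham K) (hacs K) x y. regular_trajectory M (hham K) (hacs K) u) \<and>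
        (\<forall>e. finite {u \<in> rigid_solutions M K x y. energy M (hham K) u \<le> e}) \<and>
        (\<forall>u\<in>rigid_solutions M K x y. hsgn K u \<in> {1, -1}))"

definition continuation :: "'e::euclidean_space cstar_mfd \<Rightarrow> 'e floer_datum \<Rightarrow> 'e floer_datum \<Rightarrow>
    'e floer_homotopy \<Rightarrow> ((real \<Rightarrow> 'e) \<Rightarrow> 'b::field novikov) \<Rightarrow> (real \<Rightarrow> 'e) \<Rightarrow> 'b novikov" where
  "continuation M D1 D2 K z x = (if x \<in> orbits M (fham D1) then
     (\<Sum>y\<in>orbits M (fham D2).
        Novikov (\<lambda>e. \<Sum>u\<in>{u \<in> rigid_solutions M K x y. energy M (hham K) u = e}. of_int (hsgn K u)) * z y)
     else 0)"

text \<open>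
  The datum whose orbits and trajectories are the images of those of \<open>D\<close> under
  \<open>x(t) \<mapsto> \<phi>(exp(-2 \<pi> i t)) x(t)\<close>; its slope is smaller by 1.
\<close>

definition seidel_datum :: "'e::euclidean_space cstar_mfd \<Rightarrow> 'e floer_datum \<Rightarrow> 'e floer_datum" where
  "seidel_datum M D =
     \<lparr>fham = \<lambda>t y. fham D t (circ M t y) - mom M y,
      facs = \<lambda>t y v. dmap (pts M) (circ M (- t)) (circ M t y)
                (facs D t (circ M t y) (dmap (pts M) (circ M t) y v)),
      fsgn = \<lambda>C. fsgn D ((\<lambda>u s t. circ M t (u s t)) ` C)\<rparr>"

text \<open>
  The orbit \<open>x\<close> is sent to \<open>t \<mapsto> \<phi>(exp(-2 \<pi> i t)) x(t)\<close>. Since the differential is weighted by energy,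
  which this bijection preserves, no power of the Novikov variable appears.
\<close>

definition seidel_cochain :: "'e::euclidean_space cstar_mfd \<Rightarrow> 'e floer_datum \<Rightarrow>
    ((real \<Rightarrow> 'e) \<Rightarrow> 'b::field novikov) \<Rightarrow> (real \<Rightarrow> 'e) \<Rightarrow> 'b novikov" where
  "seidel_cochain M D z x =
     (if x \<in> orbits M (fham (seidel_datum M D)) then z (\<lambda>t. circ M t (x t)) else 0)"


section \<open>Singular cohomology with Novikov coefficients\<close>

text \<open>A cochain is a function of pairs of a degree and a singular simplex of that degree.\<close>

definition sing_cochains :: "'a::topological_space set \<Rightarrow>
    (nat \<times> ((nat \<Rightarrow> real) \<Rightarrow> 'a) \<Rightarrow> 'b::field novikov) set" where
  "sing_cochains Y = {z. (\<forall>k \<sigma>. \<not> singular_simplex k (top_of_set Y) \<sigma> \<longrightarrow> z (k, \<sigma>) = 0) \<and>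
     finite {k. \<exists>\<sigma>. z (k, \<sigma>) \<noteq> 0}}"

definition sing_diff :: "'a::topological_space set \<Rightarrow>
    (nat \<times> ((nat \<Rightarrow> real) \<Rightarrow> 'a) \<Rightarrow> 'b::field novikov) \<Rightarrow> nat \<times> ((nat \<Rightarrow> real) \<Rightarrow> 'a) \<Rightarrow> 'b novikov" where
  "sing_diff Y z = (\<lambda>(k, \<sigma>). if 0 < k \<and> singular_simplex k (top_of_set Y) \<sigma>
     then (\<Sum>i\<le>k. (- 1) ^ i * z (k - 1, singular_face k i \<sigma>)) else 0)"

definition sing_cocycles :: "'a::topological_space set \<Rightarrow>
    (nat \<times> ((nat \<Rightarrow> real) \<Rightarrow> 'a) \<Rightarrow> 'b::field novikov) set" where
  "sing_cocycles Y = {z \<in> sing_cochains Y. sing_diff Y z = (\<lambda>_. 0)}"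

definition sing_homogeneous :: "nat \<Rightarrow> int \<Rightarrow>
    (nat \<times> ((nat \<Rightarrow> real) \<Rightarrow> 'a) \<Rightarrow> 'b::field novikov) set" where
  "sing_homogeneous N k = {z. \<forall>i \<sigma>. z (i, \<sigma>) \<noteq> 0 \<longrightarrow> same_degree N (int i) k}"


section \<open>Persistence modules and barcodes\<close>

text \<open>
  The index set consists of the extended reals other than \<open>-\<infinity>\<close>. All spaces are subspaces of one
  vector space with scalar multiplication \<open>sc\<close>; \<open>\<psi> q p\<close> is the structure map from index \<open>p\<close> to
  index \<open>q\<close>.
\<close>

definition linear_map_on :: "('k::field \<Rightarrow> 'v::ab_group_add \<Rightarrow> 'v) \<Rightarrow> 'v set \<Rightarrow> ('v \<Rightarrow> 'v) \<Rightarrow> bool" where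
  "linear_map_on sc V f \<longleftrightarrow> (\<forall>a. \<forall>u\<in>V. \<forall>v\<in>V. f (sc a u + v) = sc a (f u) + f v)"

definition persistence_module :: "('k::field \<Rightarrow> 'v::ab_group_add \<Rightarrow> 'v) \<Rightarrow> (ereal \<Rightarrow> 'v set) \<Rightarrow>
    (ereal \<Rightarrow> ereal \<Rightarrow> 'v \<Rightarrow> 'v) \<Rightarrow> bool" where
  "persistence_module sc V \<psi> \<longleftrightarrow> vector_space sc \<and>
     (\<forall>p. p \<noteq> -\<infinity> \<longrightarrow> module.subspace sc (V p) \<and> (\<forall>v\<in>V p. \<psi> p p v = v)) \<and>
     (\<forall>p q. p \<noteq> -\<infinity> \<and> p \<le> q \<longrightarrow> linear_map_on sc (V p) (\<psi> q p) \<and> \<psi> q p ` V p \<subseteq> V q) \<and>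
     (\<forall>p q r. p \<noteq> -\<infinity> \<and> p \<le> q \<and> q \<le> r \<longrightarrow> (\<forall>v\<in>V p. \<psi> r q (\<psi> q p v) = \<psi> r p v))"

text \<open>\<open>G p k\<close> is the part of \<open>V p\<close> of degree \<open>k\<close>, where \<open>k\<close> represents a class modulo \<open>2 N\<close>.\<close>

definition graded_persistence_module :: "('k::field \<Rightarrow> 'v::ab_group_add \<Rightarrow> 'v) \<Rightarrow> nat \<Rightarrow>
    (ereal \<Rightarrow> 'v set) \<Rightarrow> (ereal \<Rightarrow> int \<Rightarrow> 'v set) \<Rightarrow> (ereal \<Rightarrow> ereal \<Rightarrow> 'v \<Rightarrow> 'v) \<Rightarrow> bool" where
  "graded_persistence_module sc N V G \<psi> \<longleftrightarrow> persistence_module sc V \<psi> \<and>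
     (\<forall>p. p \<noteq> -\<infinity> \<longrightarrow>
        (\<forall>k. module.subspace sc (G p k) \<and> G p k \<subseteq> V p) \<and>
        (\<forall>k l. same_degree N k l \<longrightarrow> G p k = G p l) \<and>
        (\<forall>v\<in>V p. \<exists>!c. (\<forall>k. c k \<in> G p k) \<and> finite {k. c k \<noteq> 0} \<and>
           (\<forall>k. N \<noteq> 0 \<and> k \<notin> {0..<2 * int N} \<longrightarrow> c k = 0) \<and> v = (\<Sum>k | c k \<noteq> 0. c k))) \<and>
     (\<forall>p q k. p \<noteq> -\<infinity> \<and> p \<le> q \<longrightarrow> \<psi> q p ` G p k \<subseteq> G q k)"

text \<open>
  A bar is given by its end points; \<open>(a, b)\<close> stands for the half-open interval from \<open>a\<close> to \<open>b\<close>, and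
  for an interval unbounded below if \<open>a = -\<infinity>\<close>. Bars with \<open>b = \<infinity>\<close> also contain the index \<open>\<infinity>\<close>.
\<close>

definition bar_set :: "ereal \<times> ereal \<Rightarrow> ereal set" where
  "bar_set I = {p. p \<noteq> -\<infinity> \<and> fst I \<le> p \<and> (p < snd I \<or> snd I = \<infinity>)}"

definition basic_space :: "ereal set \<Rightarrow> ereal \<Rightarrow> 'k::field set" where
  "basic_space I p = (if p \<in> I then UNIV else {0})"

definition basic_map :: "ereal set \<Rightarrow> ereal \<Rightarrow> ereal \<Rightarrow> 'k::field \<Rightarrow> 'k" where
  "basic_map I q p c = (if p \<in> I \<and> q \<in> I then c else 0)"

definition bars_space :: "'j set \<Rightarrow> ('j \<Rightarrow> ereal \<times> ereal) \<Rightarrow> ereal \<Rightarrow> ('j \<Rightarrow> 'k::field) set" where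
  "bars_space J bar p = {f. finite {j. f j \<noteq> 0} \<and> (\<forall>j. j \<notin> J \<longrightarrow> f j = 0) \<and>
     (\<forall>j\<in>J. f j \<in> basic_space (bar_set (bar j)) p)}"

definition bars_map :: "('j \<Rightarrow> ereal \<times> ereal) \<Rightarrow> ereal \<Rightarrow> ereal \<Rightarrow> ('j \<Rightarrow> 'k::field) \<Rightarrow> 'j \<Rightarrow> 'k" where
  "bars_map bar q p f j = basic_map (bar_set (bar j)) q p (f j)"

definition bars_iso :: "('k::field \<Rightarrow> 'v::ab_group_add \<Rightarrow> 'v) \<Rightarrow> (ereal \<Rightarrow> 'v set) \<Rightarrow>
    (ereal \<Rightarrow> ereal \<Rightarrow> 'v \<Rightarrow> 'v) \<Rightarrow> 'j set \<Rightarrow> ('j \<Rightarrow> ereal \<times> ereal) \<Rightarrow> (ereal \<Rightarrow> ('j \<Rightarrow> 'k) \<Rightarrow> 'v) \<Rightarrow> bool" where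
  "bars_iso sc V \<psi> J bar h \<longleftrightarrow>
     (\<forall>j\<in>J. fst (bar j) \<noteq> \<infinity> \<and> snd (bar j) \<noteq> -\<infinity> \<and> fst (bar j) < snd (bar j)) \<and>
     (\<forall>p. p \<noteq> -\<infinity> \<longrightarrow> bij_betw (h p) (bars_space J bar p) (V p) \<and>
        (\<forall>a. \<forall>f\<in>bars_space J bar p. \<forall>g\<in>bars_space J bar p.
           h p (\<lambda>j. a * f j + g j) = sc a (h p f) + h p g)) \<and>
     (\<forall>p q. p \<noteq> -\<infinity> \<and> p \<le> q \<longrightarrow>
        (\<forall>f\<in>bars_space J bar p. h q (bars_map bar q p f) = \<psi> q p (h p f)))"

definition is_barcode :: "('k::field \<Rightarrow> 'v::ab_group_add \<Rightarrow> 'v) \<Rightarrow> (ereal \<Rightarrow> 'v set) \<Rightarrow>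
    (ereal \<Rightarrow> ereal \<Rightarrow> 'v \<Rightarrow> 'v) \<Rightarrow> 'j set \<Rightarrow> ('j \<Rightarrow> ereal \<times> ereal) \<Rightarrow> bool" where
  "is_barcode sc V \<psi> J bar \<longleftrightarrow> (\<exists>h. bars_iso sc V \<psi> J bar h)"

definition is_graded_barcode :: "('k::field \<Rightarrow> 'v::ab_group_add \<Rightarrow> 'v) \<Rightarrow> nat \<Rightarrow> (ereal \<Rightarrow> 'v set) \<Rightarrow>
    (ereal \<Rightarrow> int \<Rightarrow> 'v set) \<Rightarrow> (ereal \<Rightarrow> ereal \<Rightarrow> 'v \<Rightarrow> 'v) \<Rightarrow> 'j set \<Rightarrow> ('j \<Rightarrow> ereal \<times> ereal) \<Rightarrow>
    ('j \<Rightarrow> int) \<Rightarrow> bool" where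
  "is_graded_barcode sc N V G \<psi> J bar d \<longleftrightarrow> (\<exists>h. bars_iso sc V \<psi> J bar h \<and>
     (\<forall>p k. p \<noteq> -\<infinity> \<longrightarrow>
        h p ` {f \<in> bars_space J bar p. \<forall>j. f j \<noteq> 0 \<longrightarrow> same_degree N (d j) k} = G p k))"


section \<open>The persistence module of a symplectic C*-manifold\<close>

text \<open>\<open>\<theta>\<close> induces an isomorphism from the quotient \<open>Z / B\<close> of spaces of cochains onto \<open>W\<close>.\<close>

definition cohomology_iso :: "('k::field \<Rightarrow> 'v::ab_group_add \<Rightarrow> 'v) \<Rightarrow> ('x \<Rightarrow> 'k) set \<Rightarrow> ('x \<Rightarrow> 'k) set \<Rightarrow>
    'v set \<Rightarrow> (('x \<Rightarrow> 'k) \<Rightarrow> 'v) \<Rightarrow> bool" where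
  "cohomology_iso sc Z B W \<theta> \<longleftrightarrow>
     (\<forall>a. \<forall>z\<in>Z. \<forall>z'\<in>Z. \<theta> (\<lambda>x. a * z x + z' x) = sc a (\<theta> z) + \<theta> z') \<and>
     \<theta> ` Z = W \<and> {z \<in> Z. \<theta> z = 0} = B"

text \<open>
  Through the isomorphisms \<open>\<theta>\<close>, the space \<open>V \<lambda>\<close> for generic \<open>\<lambda>\<close> is the Floer cohomology of a chosen
  datum of slope \<open>\<lambda>\<close>, and the structure maps are continuation maps; \<open>V 0\<close> is the cohomology of the
  manifold. For \<open>p = 0\<close> and for non-generic \<open>p > 0\<close>, the space \<open>V p\<close> is identified by the structure
  map with the Floer cohomology of all sufficiently close larger slopes. \<open>V \<infinity>\<close> is the direct limit.
\<close>

definition floer_part :: "'n::finite itself \<Rightarrow> 'e::euclidean_space cstar_mfd \<Rightarrow> nat \<Rightarrow>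
    (real \<Rightarrow> 'e floer_datum) \<Rightarrow> (real \<Rightarrow> real \<Rightarrow> 'e floer_homotopy) \<Rightarrow>
    (real \<Rightarrow> ((real \<Rightarrow> 'e) \<Rightarrow> 'b::field novikov) \<Rightarrow> 'v) \<Rightarrow>
    ('b novikov \<Rightarrow> 'v::ab_group_add \<Rightarrow> 'v) \<Rightarrow> (ereal \<Rightarrow> 'v set) \<Rightarrow> (ereal \<Rightarrow> int \<Rightarrow> 'v set) \<Rightarrow>
    (ereal \<Rightarrow> ereal \<Rightarrow> 'v \<Rightarrow> 'v) \<Rightarrow> bool" where
  "floer_part TN M N D K \<theta> sc V G \<psi> \<longleftrightarrow>
     (\<exists>\<theta>0. cohomology_iso sc (sing_cocycles (pts M)) (sing_diff (pts M) ` sing_cochains (pts M))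
         (V 0) \<theta>0 \<and>
       (\<forall>k. G 0 k = \<theta>0 ` (sing_cocycles (pts M) \<inter> sing_homogeneous N k))) \<and>
     (\<forall>l. generic_slope M l \<longrightarrow> floer_datum_of_slope M l (D l) \<and>
        cohomology_iso sc (floer_cocycles M (D l)) (floer_coboundaries M (D l)) (V (ereal l)) (\<theta> l) \<and>
        (\<forall>k. G (ereal l) k = \<theta> l ` (floer_cocycles M (D l) \<inter> floer_homogeneous TN M N (D l) k))) \<and>
     (\<forall>l m. generic_slope M l \<and> generic_slope M m \<and> l \<le> m \<longrightarrow>
        floer_homotopy_between M (D m) (D l) (K l m) \<and>
        (\<forall>z\<in>floer_cocycles M (D l). continuation M (D m) (D l) (K l m) z \<in> floer_cocycles M (D m) \<and>
           \<psi> (ereal m) (ereal l) (\<theta> l z) = \<theta> m (continuation M (D m) (D l) (K l m) z))) \<and>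
     (\<forall>p\<ge>0. \<not> generic_slope M p \<longrightarrow> (\<exists>q>p. \<forall>r. p < r \<and> r < q \<longrightarrow>
        generic_slope M r \<and> bij_betw (\<psi> (ereal r) (ereal p)) (V (ereal p)) (V (ereal r)))) \<and>
     V \<infinity> = (\<Union>p. \<psi> \<infinity> (ereal p) ` V (ereal p)) \<and>
     (\<forall>p. \<forall>v\<in>V (ereal p). \<psi> \<infinity> (ereal p) v = 0 \<longrightarrow> (\<exists>q\<ge>p. \<psi> (ereal q) (ereal p) v = 0))"

text \<open>
  \<open>S p\<close> is the Seidel isomorphism from \<open>V p\<close> to \<open>V (p - 1)\<close>. For generic slopes above 1 it is the map
  of orbits followed by the continuation map \<open>L\<close> to the chosen datum of slope \<open>\<lambda> - 1\<close>. At negative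
  indices the module is defined by periodicity: the space at \<open>p - 1 < 0\<close> is that at \<open>p\<close> with degrees
  shifted, and \<open>S p\<close> is the identity.
\<close>

definition seidel_part :: "'n::finite itself \<Rightarrow> 'e::euclidean_space cstar_mfd \<Rightarrow> int \<Rightarrow>
    (real \<Rightarrow> 'e floer_datum) \<Rightarrow> (real \<Rightarrow> 'e floer_homotopy) \<Rightarrow>
    (real \<Rightarrow> ((real \<Rightarrow> 'e) \<Rightarrow> 'b::field novikov) \<Rightarrow> 'v) \<Rightarrow>
    ('b novikov \<Rightarrow> 'v::ab_group_add \<Rightarrow> 'v) \<Rightarrow> (ereal \<Rightarrow> 'v set) \<Rightarrow> (ereal \<Rightarrow> int \<Rightarrow> 'v set) \<Rightarrow>
    (ereal \<Rightarrow> ereal \<Rightarrow> 'v \<Rightarrow> 'v) \<Rightarrow> (ereal \<Rightarrow> 'v \<Rightarrow> 'v) \<Rightarrow> bool" where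
  "seidel_part TN M \<mu> D L \<theta> sc V G \<psi> S \<longleftrightarrow>
     (\<forall>l>1. generic_slope M l \<longrightarrow>
        floer_homotopy_between M (D (l - 1)) (seidel_datum M (D l)) (L l) \<and>
        (\<forall>z\<in>floer_cocycles M (D l).
           let z' = continuation M (D (l - 1)) (seidel_datum M (D l)) (L l) (seidel_cochain M (D l) z)
           in z' \<in> floer_cocycles M (D (l - 1)) \<and> S (ereal l) (\<theta> l z) = \<theta> (l - 1) z')) \<and>
     (\<forall>p<1. V (ereal (p - 1)) = V (ereal p) \<and>
        (\<forall>k. G (ereal (p - 1)) (k + 2 * \<mu>) = G (ereal p) k) \<and> (\<forall>v\<in>V (ereal p). S (ereal p) v = v)) \<and>
     (\<forall>p. p \<noteq> -\<infinity> \<longrightarrow> linear_map_on sc (V p) (S p) \<and> bij_betw (S p) (V p) (V (p - 1)) \<and>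
        (\<forall>k. S p ` G p k = G (p - 1) (k + 2 * \<mu>))) \<and>
     (\<forall>p q. p \<noteq> -\<infinity> \<and> p \<le> q \<longrightarrow>
        (\<forall>v\<in>V p. S q (\<psi> q p v) = \<psi> (q - 1) (p - 1) (S p v)))"

definition associated_persistence_module :: "'n::finite itself \<Rightarrow> 'e::euclidean_space cstar_mfd \<Rightarrow>
    nat \<Rightarrow> int \<Rightarrow> ('b::field novikov \<Rightarrow> 'v::ab_group_add \<Rightarrow> 'v) \<Rightarrow> (ereal \<Rightarrow> 'v set) \<Rightarrow>
    (ereal \<Rightarrow> int \<Rightarrow> 'v set) \<Rightarrow> (ereal \<Rightarrow> ereal \<Rightarrow> 'v \<Rightarrow> 'v) \<Rightarrow> (ereal \<Rightarrow> 'v \<Rightarrow> 'v) \<Rightarrow> bool" where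
  "associated_persistence_module TN M N \<mu> sc V G \<psi> S \<longleftrightarrow>
     graded_persistence_module sc N V G \<psi> \<and>
     (\<exists>D K L \<theta>. floer_part TN M N D K \<theta> sc V G \<psi> \<and> seidel_part TN M \<mu> D L \<theta> sc V G \<psi> S)"

end

theory Submission
  imports Defs "HOL-Library.Function_Algebras"
begin

text \<open>
  The Seidel maps carry a decomposition of \<open>V\<close> into bars to another one, with all bars translated by
  \<open>-1\<close> and degrees raised by \<open>2 * \<mu>\<close>, so the claim is an instance of the uniqueness of barcodes. For
  uniqueness, fix an interval \<open>I\<close> and an index \<open>p\<close> in it. In \<open>V p\<close>, consider the vectors which die no
  later than \<open>I\<close> ends and which come from every index of \<open>I\<close> below \<open>p\<close>, modulo sums of a vector that
  dies inside \<open>I\<close> and a vector that comes from before \<open>I\<close>. This quotient depends on \<open>V\<close> only, and in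
  any decomposition the bars equal to \<open>I\<close> form a basis of it. As there may be infinitely many bars,
  multiplicities are compared as cardinalities of bases.
\<close>

section \<open>Finitely supported functions\<close>

text \<open>The vector space with basis \<open>A\<close>. Its elements are functions on the whole
  type, so that spaces for different \<open>A\<close> share one ambient space.\<close>

definition fin_supp :: "'i set \<Rightarrow> ('i \<Rightarrow> 'k::zero) set" where
  "fin_supp A = {f. finite {i. f i \<noteq> 0} \<and> (\<forall>i. f i \<noteq> 0 \<longrightarrow> i \<in> A)}"

definition unit_fun :: "'i \<Rightarrow> 'i \<Rightarrow> 'k::zero_neq_one" where
  "unit_fun i j = (if j = i then 1 else 0)"

interpretation fun_vs: vector_space "\<lambda>(c::'k::field) (f::'i \<Rightarrow> 'k) i. c * f i"
  by unfold_locales (auto simp: fun_eq_iff algebra_simps)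

lemma sum_fun_apply: "sum f A x = (\<Sum>a\<in>A. f a x)"
  for f :: "'a \<Rightarrow> 'b \<Rightarrow> 'c::comm_monoid_add"
  by (induction A rule: infinite_finite_induct) auto

lemma inj_unit_fun: "inj (unit_fun :: 'i \<Rightarrow> 'i \<Rightarrow> 'k::field)"
  by (rule injI) (metis unit_fun_def zero_neq_one)

lemma unit_fun_combination:
  "finite s \<Longrightarrow> (\<Sum>i\<in>s. (\<lambda>j. c i * unit_fun i j)) = (\<lambda>j. if j \<in> s then c j else (0::'k::field))"
  by (auto simp: fun_eq_iff sum_fun_apply unit_fun_def if_distrib cong: if_cong)

lemma fin_supp_subspace: "fun_vs.subspace (fin_supp A :: ('i \<Rightarrow> 'k::field) set)"
proof (rule fun_vs.subspaceI)
  fix f g :: "'i \<Rightarrow> 'k" and c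
  assume f: "f \<in> fin_supp A"
  show "(\<lambda>i. c * f i) \<in> fin_supp A"
    using f by (auto simp: fin_supp_def)
  assume g: "g \<in> fin_supp A"
  have "{i. (f + g) i \<noteq> 0} \<subseteq> {i. f i \<noteq> 0} \<union> {i. g i \<noteq> 0}" by auto
  moreover have "finite ({i. f i \<noteq> 0} \<union> {i. g i \<noteq> 0})" using f g by (simp add: fin_supp_def)
  ultimately have "finite {i. (f + g) i \<noteq> 0}" by (rule finite_subset)
  moreover have "i \<in> A" if "(f + g) i \<noteq> 0" for i
    using that f g by (cases "f i = 0") (auto simp: fin_supp_def)
  ultimately show "f + g \<in> fin_supp A" by (simp add: fin_supp_def del: plus_fun_apply)
qed (simp add: fin_supp_def)

lemma unit_fun_in_fin_supp: "i \<in> A \<Longrightarrow> unit_fun i \<in> fin_supp A"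
  by (auto simp: fin_supp_def unit_fun_def split: if_splits)

lemma span_unit_fun: "fun_vs.span (unit_fun ` A) = (fin_supp A :: ('i \<Rightarrow> 'k::field) set)"
proof
  show "fun_vs.span (unit_fun ` A) \<subseteq> (fin_supp A :: ('i \<Rightarrow> 'k) set)"
    by (rule fun_vs.span_minimal) (auto intro: unit_fun_in_fin_supp fin_supp_subspace)
  show "(fin_supp A :: ('i \<Rightarrow> 'k) set) \<subseteq> fun_vs.span (unit_fun ` A)"
  proof
    fix f :: "'i \<Rightarrow> 'k" assume f: "f \<in> fin_supp A"
    then have "f = (\<Sum>i | f i \<noteq> 0. (\<lambda>j. f i * unit_fun i j))"
      by (subst unit_fun_combination) (auto simp: fin_supp_def)
    moreover have "\<dots> \<in> fun_vs.span (unit_fun ` A)"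
      using f by (intro fun_vs.span_sum fun_vs.span_scale fun_vs.span_base) (auto simp: fin_supp_def)
    ultimately show "f \<in> fun_vs.span (unit_fun ` A)" by simp
  qed
qed

text \<open>The unit functions are independent, and injective linear maps preserve this.
  \<open>T\<close> is controlled on \<open>fin_supp A\<close> alone, so linearity is assumed there.
  Injectivity of the indexing is recorded because passing to the image set could otherwise lose
  elements of \<open>A\<close>.\<close>

lemma independent_injective_linear_image:
  fixes T :: "('i \<Rightarrow> 'k::field) \<Rightarrow> 'j \<Rightarrow> 'k"
  assumes lin: "\<And>a f g. f \<in> fin_supp A \<Longrightarrow> g \<in> fin_supp A \<Longrightarrow>
      T (\<lambda>i. a * f i + g i) = (\<lambda>j. a * T f j + T g j)"
    and inj: "\<And>f. f \<in> fin_supp A \<Longrightarrow> T f = (\<lambda>j. 0) \<Longrightarrow> f = (\<lambda>i. 0)"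
  shows "inj_on (T \<circ> unit_fun) A" "fun_vs.independent ((T \<circ> unit_fun) ` A)"
proof -
  have zero: "(\<lambda>i. 0) \<in> (fin_supp A :: ('i \<Rightarrow> 'k) set)" by (simp add: fin_supp_def)
  \<comment> \<open>Linearity with coefficient -1 reads \<open>T 0 = - T 0 + T 0\<close>.\<close>
  have T0: "T (\<lambda>i. 0) = (\<lambda>j. 0)"
    using lin[OF zero zero, of "- 1"] by simp
  have comb: "T (\<Sum>i\<in>s. (\<lambda>j. c i * unit_fun i j)) = (\<Sum>i\<in>s. (\<lambda>j. c i * T (unit_fun i) j))"
    if "finite s" "s \<subseteq> A" for s and c :: "'i \<Rightarrow> 'k"
    using that
  proof (induction s)
    case empty
    then show ?case using T0 by (simp add: zero_fun_def)
  next
    case (insert i s)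
    have "(\<Sum>i\<in>s. (\<lambda>j. c i * unit_fun i j)) \<in> fin_supp A"
      unfolding unit_fun_combination[OF insert.hyps(1)] using insert
      by (auto simp: fin_supp_def intro: finite_subset[of _ s])
    with insert lin[of "unit_fun i" "\<Sum>i\<in>s. (\<lambda>j. c i * unit_fun i j)" "c i"] show ?case
      by (simp add: unit_fun_in_fin_supp plus_fun_def)
  qed
  show inj_TU: "inj_on (T \<circ> unit_fun) A"
  proof (rule inj_onI)
    fix x y assume xy: "x \<in> A" "y \<in> A" "(T \<circ> unit_fun) x = (T \<circ> unit_fun) y"
    let ?f = "\<lambda>i. - 1 * unit_fun x i + unit_fun y i :: 'k"
    have "T ?f = (\<lambda>j. 0)" using xy by (subst lin) (auto simp: unit_fun_in_fin_supp)
    moreover have "?f \<in> fin_supp A" using xy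
      by (auto simp: fin_supp_def unit_fun_def intro: finite_subset[of _ "{x, y}"] split: if_splits)
    ultimately have "?f = (\<lambda>i. 0)" by (rule inj[rotated])
    then have "unit_fun x x = (unit_fun y x :: 'k)" by (metis add_eq_0_iff minus_minus mult_minus1)
    then show "x = y" by (auto simp: unit_fun_def split: if_splits)
  qed
  show "fun_vs.independent ((T \<circ> unit_fun) ` A)"
    unfolding fun_vs.independent_explicit_module
  proof (intro allI impI)
    fix t u v
    assume t: "finite t" "t \<subseteq> (T \<circ> unit_fun) ` A" "(\<Sum>v\<in>t. (\<lambda>i. u v * v i)) = 0" "v \<in> t"
    \<comment> \<open>Pull the relation back along \<open>T\<close>: with the same coefficients on
      the unit functions indexed by \<open>s\<close> it becomes an element \<open>?f\<close> of the
      kernel.\<close>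
    obtain s where s: "s \<subseteq> A" "t = (T \<circ> unit_fun) ` s" using t(2) by (meson subset_imageE)
    have inj_s: "inj_on (T \<circ> unit_fun) s" using inj_TU s(1) by (rule inj_on_subset)
    have fin: "finite s" using t(1) inj_s unfolding s(2) by (rule finite_imageD)
    let ?f = "\<Sum>i\<in>s. (\<lambda>j. u (T (unit_fun i)) * unit_fun i j)"
    have f_eq: "?f = (\<lambda>j. if j \<in> s then u (T (unit_fun j)) else 0)"
      by (rule unit_fun_combination[OF fin])
    have "T ?f = (\<Sum>v\<in>t. (\<lambda>i. u v * v i))"
      unfolding comb[OF fin s(1)] s(2) by (subst sum.reindex[OF inj_s]) (simp add: o_def)
    then have "T ?f = (\<lambda>j. 0)" using t(3) by (simp add: zero_fun_def)
    moreover have "?f \<in> fin_supp A" unfolding f_eq using fin s(1)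
      by (auto simp: fin_supp_def intro: finite_subset[of _ s])
    ultimately have "?f = (\<lambda>i. 0)" by (rule inj[rotated])
    moreover obtain i where i: "i \<in> s" "v = T (unit_fun i)" using t(4) s(2) by auto
    ultimately show "u v = 0" unfolding f_eq by (auto dest: fun_cong[of _ _ i])
  qed
qed

text \<open>Monotonicity of dimension, as a comparison of cardinalities that also covers infinite
  bases: the images of the unit functions form an independent set, which extends to a basis of
  \<open>fin_supp B\<close>, and any two bases are equinumerous.\<close>

lemma lepoll_of_injective_linear:
  fixes T :: "('i \<Rightarrow> 'k::field) \<Rightarrow> 'j \<Rightarrow> 'k"
  assumes lin: "\<And>a f g. f \<in> fin_supp A \<Longrightarrow> g \<in> fin_supp A \<Longrightarrow>
      T (\<lambda>i. a * f i + g i) = (\<lambda>j. a * T f j + T g j)"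
    and inj: "\<And>f. f \<in> fin_supp A \<Longrightarrow> T f = (\<lambda>j. 0) \<Longrightarrow> f = (\<lambda>i. 0)"
    and into: "\<And>f. f \<in> fin_supp A \<Longrightarrow> T f \<in> fin_supp B"
  shows "A \<lesssim> B"
proof -
  let ?S = "(T \<circ> unit_fun) ` A" and ?E = "unit_fun ` B :: ('j \<Rightarrow> 'k) set"
  have T: "inj_on (T \<circ> unit_fun) A" "fun_vs.independent ?S"
    by (rule independent_injective_linear_image[where T = T]; fact lin inj)+
  \<comment> \<open>The case of the identity map: the unit functions themselves are
    independent.\<close>
  have "fun_vs.independent ((id \<circ> unit_fun) ` B :: ('j \<Rightarrow> 'k) set)"
    by (rule independent_injective_linear_image(2)[where T = id]) auto
  then have E: "fun_vs.independent ?E" by simp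
  have "?S \<subseteq> fun_vs.span ?E"
    using into by (auto simp: span_unit_fun unit_fun_in_fin_supp)
  then obtain C where C: "?S \<subseteq> C" "C \<subseteq> fun_vs.span ?E" "fun_vs.independent C"
      "fun_vs.span ?E \<subseteq> fun_vs.span C"
    using fun_vs.maximal_independent_subset_extend[OF _ T(2)] by metis
  have "fun_vs.span C = fun_vs.span ?E"
    using C(4) fun_vs.span_minimal[OF C(2) fun_vs.subspace_span] by auto
  then have "C \<approx> ?E"
    using fun_vs.bij_if_span_eq_span_bases[OF C(3) E] by (simp add: eqpoll_def)
  have "A \<approx> ?S" using T(1) by (meson eqpoll_def bij_betw_imageI)
  also have "?S \<lesssim> C" using C(1) by (rule subset_imp_lepoll)
  also have "C \<approx> ?E" by fact
  also have "?E \<approx> B"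
    by (rule eqpoll_sym) (meson eqpoll_def bij_betw_imageI inj_unit_fun inj_on_subset subset_UNIV)
  finally show ?thesis .
qed

section \<open>Kernels and images in a barcode\<close>

lemma bars_space_restrict:
  "f \<in> bars_space J bar p \<Longrightarrow> (\<lambda>j. if P j then f j else 0) \<in> bars_space J bar p"
  unfolding bars_space_def by (auto simp: basic_space_def intro: finite_subset[of _ "{j. f j \<noteq> 0}"])

lemma bars_spaceI:
  assumes "finite {j. f j \<noteq> 0}" "\<And>j. f j \<noteq> 0 \<Longrightarrow> j \<in> J" "\<And>j. f j \<noteq> 0 \<Longrightarrow> p \<in> bar_set (bar j)"
  shows "f \<in> bars_space J bar p"
  using assms unfolding bars_space_def basic_space_def by auto

lemma bars_space_support:
  assumes "f \<in> bars_space J bar p"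
  shows "finite {j. f j \<noteq> 0}" "f j \<noteq> 0 \<Longrightarrow> j \<in> J" "f j \<noteq> 0 \<Longrightarrow> p \<in> bar_set (bar j)"
  using assms unfolding bars_space_def basic_space_def by (auto split: if_splits)

lemma bars_space_lincomb:
  assumes "f \<in> bars_space J bar p" "g \<in> bars_space J bar p"
  shows "(\<lambda>j. a * f j + g j) \<in> bars_space J bar p"
proof (rule bars_spaceI)
  show "finite {j. a * f j + g j \<noteq> 0}"
    by (rule finite_subset[of _ "{j. f j \<noteq> 0} \<union> {j. g j \<noteq> 0}"])
      (use assms in \<open>auto dest: bars_space_support\<close>)
  show "j \<in> J" "p \<in> bar_set (bar j)" if "a * f j + g j \<noteq> 0" for j
    using that assms[THEN bars_space_support(2)] assms[THEN bars_space_support(3)]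
    by (metis add.right_neutral mult_zero_right)+
qed

lemma bars_space_zero: "(\<lambda>j. 0) \<in> bars_space J bar p"
  by (rule bars_spaceI) auto

lemma bars_map_in_bars_space:
  assumes "f \<in> bars_space J bar p" shows "bars_map bar q p f \<in> bars_space J bar q"
proof (rule bars_spaceI)
  show "finite {j. bars_map bar q p f j \<noteq> 0}"
    by (rule finite_subset[OF _ bars_space_support(1)[OF assms]])
      (auto simp: bars_map_def basic_map_def)
qed (use bars_space_support[OF assms] in \<open>auto simp: bars_map_def basic_map_def split: if_splits\<close>)

text \<open>
  The subquotient of \<open>V p\<close> that sees only the bars equal to \<open>I\<close> is \<open>interval_part\<close> modulo its
  intersection with \<open>smaller_part\<close>. The alternative \<open>v\<^sub>2 = 0\<close> covers an interval unbounded below, before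
  which there is no index.
\<close>

definition interval_part :: "(ereal \<Rightarrow> 'v set) \<Rightarrow> (ereal \<Rightarrow> ereal \<Rightarrow> 'v \<Rightarrow> 'v::ab_group_add) \<Rightarrow>
    ereal \<times> ereal \<Rightarrow> ereal \<Rightarrow> 'v set" where
  "interval_part V \<psi> I p = {v \<in> V p. (\<forall>q\<ge>p. q \<notin> bar_set I \<longrightarrow> \<psi> q p v = 0) \<and>
     (\<forall>q\<le>p. q \<in> bar_set I \<longrightarrow> v \<in> \<psi> p q ` V q)}"

definition smaller_part :: "(ereal \<Rightarrow> 'v set) \<Rightarrow> (ereal \<Rightarrow> ereal \<Rightarrow> 'v \<Rightarrow> 'v::ab_group_add) \<Rightarrow>
    ereal \<times> ereal \<Rightarrow> ereal \<Rightarrow> 'v set" where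
  "smaller_part V \<psi> I p = {v\<^sub>1 + v\<^sub>2 | v\<^sub>1 v\<^sub>2. v\<^sub>1 \<in> V p \<and> v\<^sub>2 \<in> V p \<and>
     (\<exists>q\<ge>p. q \<in> bar_set I \<and> \<psi> q p v\<^sub>1 = 0) \<and>
     (v\<^sub>2 = 0 \<or> (\<exists>q\<le>p. q \<noteq> -\<infinity> \<and> q \<notin> bar_set I \<and> v\<^sub>2 \<in> \<psi> p q ` V q))}"

text \<open>The isomorphism \<open>h\<close> belongs to the data because two decompositions of one
  module will be compared.\<close>

locale bar_decomposition =
  fixes sc :: "'k::field \<Rightarrow> 'v::ab_group_add \<Rightarrow> 'v" and V \<psi>
    and J :: "'j set" and bar and h
  assumes pm: "persistence_module sc V \<psi>" and iso: "bars_iso sc V \<psi> J bar h"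
begin

sublocale vector_space sc
  using pm by (simp add: persistence_module_def)

section \<open>Vectors and their coordinates in a fixed decomposition\<close>

lemma bar_proper: "j \<in> J \<Longrightarrow> fst (bar j) \<noteq> \<infinity>" "j \<in> J \<Longrightarrow> snd (bar j) \<noteq> -\<infinity>"
    "j \<in> J \<Longrightarrow> fst (bar j) < snd (bar j)"
  using iso by (auto simp: bars_iso_def)

lemma h_bij: "p \<noteq> -\<infinity> \<Longrightarrow> bij_betw (h p) (bars_space J bar p) (V p)"
  using iso by (auto simp: bars_iso_def)

lemma h_in: "p \<noteq> -\<infinity> \<Longrightarrow> f \<in> bars_space J bar p \<Longrightarrow> h p f \<in> V p"
  using h_bij bij_betwE by blast

lemma h_inj: "p \<noteq> -\<infinity> \<Longrightarrow> f \<in> bars_space J bar p \<Longrightarrow> g \<in> bars_space J bar p \<Longrightarrow>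
    h p f = h p g \<Longrightarrow> f = g"
  using h_bij by (meson bij_betw_def inj_onD)

lemma h_obtain:
  assumes "p \<noteq> -\<infinity>" "v \<in> V p" obtains f where "f \<in> bars_space J bar p" "h p f = v"
  using h_bij[OF assms(1)] assms(2) by (metis bij_betw_imp_surj_on imageE)

lemma h_lin: "p \<noteq> -\<infinity> \<Longrightarrow> f \<in> bars_space J bar p \<Longrightarrow> g \<in> bars_space J bar p \<Longrightarrow>
    h p (\<lambda>j. a * f j + g j) = sc a (h p f) + h p g"
  using iso by (auto simp: bars_iso_def)

lemma h_add: "p \<noteq> -\<infinity> \<Longrightarrow> f \<in> bars_space J bar p \<Longrightarrow> g \<in> bars_space J bar p \<Longrightarrow>
    h p (\<lambda>j. f j + g j) = h p f + h p g"
  using h_lin[of p f g 1] by simp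

lemma h_zero: "p \<noteq> -\<infinity> \<Longrightarrow> h p (\<lambda>j. 0) = 0"
  using h_add[OF _ bars_space_zero bars_space_zero, of p] by simp

lemma h_map: "p \<noteq> -\<infinity> \<Longrightarrow> p \<le> q \<Longrightarrow> f \<in> bars_space J bar p \<Longrightarrow>
    h q (bars_map bar q p f) = \<psi> q p (h p f)"
  using iso by (auto simp: bars_iso_def)

text \<open>In coordinates the structure maps are diagonal: a coordinate survives to
  \<open>q\<close> exactly if its bar does.\<close>

lemma kernel_iff:
  assumes "p \<noteq> -\<infinity>" "p \<le> q" and f: "f \<in> bars_space J bar p"
  shows "\<psi> q p (h p f) = 0 \<longleftrightarrow> (\<forall>j. f j \<noteq> 0 \<longrightarrow> q \<notin> bar_set (bar j))"
proof -
  have q: "q \<noteq> -\<infinity>" using assms by auto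
  have "\<psi> q p (h p f) = 0 \<longleftrightarrow> h q (bars_map bar q p f) = h q (\<lambda>j. 0)"
    by (simp add: h_map[OF assms] h_zero[OF q])
  also have "\<dots> \<longleftrightarrow> bars_map bar q p f = (\<lambda>j. 0)"
    using h_inj[OF q bars_map_in_bars_space[OF f] bars_space_zero] by auto
  also have "\<dots> \<longleftrightarrow> (\<forall>j. f j \<noteq> 0 \<longrightarrow> q \<notin> bar_set (bar j))"
    using bars_space_support(3)[OF f] by (auto simp: bars_map_def basic_map_def fun_eq_iff)
  finally show ?thesis .
qed

text \<open>Coordinates are never changed by a structure map, only set to zero, so a preimage must
  have its bars alive at \<open>q\<close> already.\<close>

lemma image_iff:
  assumes "q \<noteq> -\<infinity>" "q \<le> p" and f: "f \<in> bars_space J bar p"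
  shows "h p f \<in> \<psi> p q ` V q \<longleftrightarrow> (\<forall>j. f j \<noteq> 0 \<longrightarrow> q \<in> bar_set (bar j))"
proof -
  have p: "p \<noteq> -\<infinity>" using assms by auto
  show ?thesis
  proof
    assume "h p f \<in> \<psi> p q ` V q"
    then obtain g where g: "g \<in> bars_space J bar q" "h p f = \<psi> p q (h q g)"
      using h_obtain[OF assms(1)] by (metis imageE)
    then have "h p f = h p (bars_map bar p q g)" by (simp add: h_map[OF assms(1,2)])
    then have "f = bars_map bar p q g"
      by (rule h_inj[OF p f bars_map_in_bars_space[OF g(1)]])
    then show "\<forall>j. f j \<noteq> 0 \<longrightarrow> q \<in> bar_set (bar j)"
      by (auto simp: bars_map_def basic_map_def)
  next
    assume *: "\<forall>j. f j \<noteq> 0 \<longrightarrow> q \<in> bar_set (bar j)"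
    \<comment> \<open>The same coordinate function, read at the index \<open>q\<close>, serves as
      preimage.\<close>
    have fq: "f \<in> bars_space J bar q"
      using * bars_space_support[OF f] by (intro bars_spaceI) auto
    have "bars_map bar p q f = f"
      using * bars_space_support(3)[OF f] by (auto simp: bars_map_def basic_map_def fun_eq_iff)
    then have "h p f = \<psi> p q (h q f)" using h_map[OF assms(1,2) fq] by simp
    then show "h p f \<in> \<psi> p q ` V q" using h_in[OF assms(1) fq] by blast
  qed
qed

section \<open>The subquotient attached to an interval, in coordinates\<close>

text \<open>A bar starting too late or ending too late is detected by a single index: one in
  \<open>I\<close> before the bar starts, or the right end of \<open>I\<close>.\<close>

lemma interval_part_support:
  assumes f: "f \<in> bars_space J bar p" and p: "p \<in> bar_set I"
    and part: "h p f \<in> interval_part V \<psi> I p" and j: "f j \<noteq> 0"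
  shows "fst (bar j) \<le> fst I" "snd (bar j) \<le> snd I"
proof -
  have p': "p \<noteq> -\<infinity>" using p by (simp add: bar_set_def)
  have pj: "p \<in> bar_set (bar j)" using bars_space_support(3)[OF f j] .
  show "fst (bar j) \<le> fst I"
  proof (rule ccontr)
    assume "\<not> fst (bar j) \<le> fst I"
    then have lt: "fst I < fst (bar j)" by simp
    \<comment> \<open>The left end of \<open>I\<close> will do, unless it is -\<infinity>, which is
      not an index; then density provides \<open>q\<close>.\<close>
    obtain q where q: "fst I \<le> q" "q < fst (bar j)" "q \<noteq> -\<infinity>"
    proof (cases "fst I = -\<infinity>")
      case True
      with lt dense[of "fst I" "fst (bar j)"] that show ?thesis by fastforce
    qed (use lt that in auto)
    have "q \<le> p" using q pj by (auto simp: bar_set_def)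
    moreover have "q \<in> bar_set I" using q p pj \<open>q \<le> p\<close> by (auto simp: bar_set_def)
    ultimately have "h p f \<in> \<psi> p q ` V q" using part by (auto simp: interval_part_def)
    then have "q \<in> bar_set (bar j)" using image_iff[OF q(3) \<open>q \<le> p\<close> f] j by auto
    then show False using q(2) by (auto simp: bar_set_def dest: leD)
  qed
  show "snd (bar j) \<le> snd I"
  proof (rule ccontr)
    assume lt: "\<not> snd (bar j) \<le> snd I"
    \<comment> \<open>The right end of \<open>I\<close> is finite or -\<infinity> here, so the
      half-open interval excludes it, while the longer bar contains it.\<close>
    then have "p \<le> snd I" "snd I \<notin> bar_set I" using p by (auto simp: bar_set_def)
    then have "\<psi> (snd I) p (h p f) = 0" using part by (auto simp: interval_part_def)
    then have "snd I \<notin> bar_set (bar j)" using kernel_iff[OF p' \<open>p \<le> snd I\<close> f] j by auto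
    then show False using lt pj \<open>p \<le> snd I\<close> p' by (auto simp: bar_set_def)
  qed
qed

lemma in_interval_partI:
  assumes f: "f \<in> bars_space J bar p" and p: "p \<in> bar_set I"
    and supp: "\<And>j. f j \<noteq> 0 \<Longrightarrow> bar j = I"
  shows "h p f \<in> interval_part V \<psi> I p"
proof -
  have p': "p \<noteq> -\<infinity>" using p by (simp add: bar_set_def)
  show ?thesis unfolding interval_part_def
  proof (intro CollectI conjI allI impI)
    show "h p f \<in> V p" using h_in[OF p' f] .
    fix q
    show "\<psi> q p (h p f) = 0" if "p \<le> q" "q \<notin> bar_set I"
      using that supp kernel_iff[OF p' that(1) f] by auto
    show "h p f \<in> \<psi> p q ` V q" if q: "q \<le> p" "q \<in> bar_set I"
    proof -
      have "q \<noteq> -\<infinity>" using q by (simp add: bar_set_def)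
      then show ?thesis using image_iff[OF _ q(1) f] supp q(2) by auto
    qed
  qed
qed

text \<open>A bar equal to \<open>I\<close> can contribute neither to a vector that dies inside
  \<open>I\<close> nor to one that comes from before \<open>I\<close>. Hence the bars equal to
  \<open>I\<close> stay independent modulo \<open>smaller_part\<close>.\<close>

lemma smaller_partD:
  assumes f: "f \<in> bars_space J bar p" and p: "p \<in> bar_set I"
    and small: "h p f \<in> smaller_part V \<psi> I p" and j: "bar j = I"
  shows "f j = 0"
proof -
  have p': "p \<noteq> -\<infinity>" using p by (simp add: bar_set_def)
  obtain v1 v2 where v: "h p f = v1 + v2" "v1 \<in> V p" "v2 \<in> V p"
    "\<exists>q\<ge>p. q \<in> bar_set I \<and> \<psi> q p v1 = 0"
    "v2 = 0 \<or> (\<exists>q\<le>p. q \<noteq> -\<infinity> \<and> q \<notin> bar_set I \<and> v2 \<in> \<psi> p q ` V q)"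
    using small by (auto simp: smaller_part_def)
  obtain f1 where f1: "f1 \<in> bars_space J bar p" "h p f1 = v1" using h_obtain[OF p' v(2)] .
  obtain f2 where f2: "f2 \<in> bars_space J bar p" "h p f2 = v2" using h_obtain[OF p' v(3)] .
  have "f1 j = 0" using v(4) kernel_iff[OF p' _ f1(1)] j by (auto simp: f1(2))
  moreover have "f2 j = 0" using v(5)
  proof
    assume "v2 = 0"
    then have "h p f2 = h p (\<lambda>j. 0)" using f2(2) h_zero[OF p'] by simp
    then have "f2 = (\<lambda>j. 0)" by (rule h_inj[OF p' f2(1) bars_space_zero])
    then show ?thesis by simp
  next
    assume "\<exists>q\<le>p. q \<noteq> -\<infinity> \<and> q \<notin> bar_set I \<and> v2 \<in> \<psi> p q ` V q"
    then show ?thesis using image_iff[OF _ _ f2(1)] j by (auto simp: f2(2))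
  qed
  moreover have "f = (\<lambda>j. f1 j + f2 j)"
    using v(1) f1 f2 bars_space_lincomb[OF f1(1) f2(1), of 1]
    by (intro h_inj[OF p' f]) (auto simp: h_add[OF p'])
  ultimately show ?thesis by simp
qed

text \<open>The bars involved neither start nor end later than \<open>I\<close>, and none equals
  \<open>I\<close>. So each ends earlier or starts earlier, and splitting the coordinates
  accordingly gives the two summands. Hence the bars equal to \<open>I\<close> generate the
  subquotient.\<close>

lemma smaller_partI:
  assumes f: "f \<in> bars_space J bar p" and p: "p \<in> bar_set I"
    and part: "h p f \<in> interval_part V \<psi> I p" and zero: "\<And>j. bar j = I \<Longrightarrow> f j = 0"
  shows "h p f \<in> smaller_part V \<psi> I p"
proof -
  have p': "p \<noteq> -\<infinity>" using p by (simp add: bar_set_def)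
  note supp = interval_part_support[OF f p part]
  \<comment> \<open>\<open>f1\<close> collects the bars ending before \<open>I\<close>; those in
    \<open>f2\<close> end together with \<open>I\<close> and therefore start strictly
    earlier.\<close>
  define f1 where "f1 = (\<lambda>j. if snd (bar j) < snd I then f j else 0)"
  define f2 where "f2 = (\<lambda>j. if \<not> snd (bar j) < snd I then f j else 0)"
  have f12: "f1 \<in> bars_space J bar p" "f2 \<in> bars_space J bar p"
    unfolding f1_def f2_def by (intro bars_space_restrict f)+
  have fin: "finite {j. f1 j \<noteq> 0}" "finite {j. f2 j \<noteq> 0}"
    using f12 bars_space_support(1) by blast+
  have "f = (\<lambda>j. f1 j + f2 j)" by (auto simp: f1_def f2_def)
  then have sum: "h p f = h p f1 + h p f2" using h_add[OF p' f12] by simp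
  \<comment> \<open>By finite support there is a last end point, and at it all bars of
    \<open>f1\<close> are over since bars exclude their right ends. Inserting \<open>p\<close>
    ensures \<open>p \<le> q\<close> and covers \<open>f1 = 0\<close>.\<close>
  define q where "q = Max (insert p ((\<lambda>j. snd (bar j)) ` {j. f1 j \<noteq> 0}))"
  have q_ge: "p \<le> q" unfolding q_def using fin(1) by (intro Max_ge) auto
  have "q \<in> insert p ((\<lambda>j. snd (bar j)) ` {j. f1 j \<noteq> 0})"
    unfolding q_def using fin(1) by (intro Max_in) auto
  then have "q < snd I \<or> snd I = \<infinity>" using p by (auto simp: bar_set_def f1_def split: if_splits)
  then have qI: "q \<in> bar_set I" using p q_ge by (auto simp: bar_set_def)
  have "snd (bar j) \<le> q" if "f1 j \<noteq> 0" for j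
    unfolding q_def using fin(1) that by (intro Max_ge) auto
  then have "q \<notin> bar_set (bar j)" if "f1 j \<noteq> 0" for j
    using that by (fastforce simp: bar_set_def f1_def split: if_splits)
  then have k1: "\<psi> q p (h p f1) = 0" using kernel_iff[OF p' q_ge f12(1)] by auto
  have f2_start: "fst (bar j) < fst I" if "f2 j \<noteq> 0" for j
  proof -
    have "f j \<noteq> 0" "snd (bar j) = snd I"
      using that supp(2)[of j] by (auto simp: f2_def split: if_splits)
    then show ?thesis using supp(1)[of j] zero[of j] by (metis order_le_less prod_eqI)
  qed
  have k2: "h p f2 = 0 \<or> (\<exists>q\<le>p. q \<noteq> -\<infinity> \<and> q \<notin> bar_set I \<and> h p f2 \<in> \<psi> p q ` V q)"
  proof (cases "\<exists>j. f2 j \<noteq> 0")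
    \<comment> \<open>This case includes every \<open>I\<close> unbounded below, as no bar starts
      before -\<infinity>.\<close>
    case False
    then have "f2 = (\<lambda>j. 0)" by auto
    then show ?thesis using h_zero[OF p'] by simp
  next
    case True
    \<comment> \<open>The latest start \<open>m\<close> may be -\<infinity>, so the index
      \<open>r\<close> is taken strictly between \<open>m\<close> and the start of \<open>I\<close>.
      It lies in all bars of \<open>f2\<close> and outside \<open>I\<close>.\<close>
    define m where "m = Max ((\<lambda>j. fst (bar j)) ` {j. f2 j \<noteq> 0})"
    have "m \<in> (\<lambda>j. fst (bar j)) ` {j. f2 j \<noteq> 0}"
      unfolding m_def using fin(2) True by (intro Max_in) auto
    then have "m < fst I" using f2_start by auto
    then obtain r where r: "m < r" "r < fst I" using dense by blast
    have start: "fst (bar j) \<le> r" if "f2 j \<noteq> 0" for j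
    proof -
      have "fst (bar j) \<le> m" unfolding m_def using fin(2) that by (intro Max_ge) auto
      then show ?thesis using r(1) by simp
    qed
    have r': "r \<noteq> -\<infinity>" "r \<le> p" "r \<notin> bar_set I" using r p by (auto simp: bar_set_def)
    have "r \<in> bar_set (bar j)" if "f2 j \<noteq> 0" for j
      using start[OF that] bars_space_support(3)[OF f12(2) that] r' by (auto simp: bar_set_def)
    then have "h p f2 \<in> \<psi> p r ` V r" using image_iff[OF r'(1,2) f12(2)] by auto
    then show ?thesis using r' by blast
  qed
  show ?thesis unfolding smaller_part_def
    using sum h_in[OF p' f12(1)] h_in[OF p' f12(2)] q_ge qI k1 k2 by blast
qed

end

section \<open>Uniqueness of barcodes\<close>

text \<open>Rewriting a combination of bars equal to \<open>I\<close> in the second decomposition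
  and keeping its coordinates at such bars is injective. The predicates select degrees; constantly
  true ones give the ungraded count.\<close>

lemma bar_multiplicity_lepoll:
  fixes sc :: "'k::field \<Rightarrow> 'v::ab_group_add \<Rightarrow> 'v" and J :: "'j set"
  assumes 1: "bar_decomposition sc V \<psi> J bar h" and 2: "bar_decomposition sc V \<psi> J' bar' h'"
    and p: "p \<in> bar_set I"
    and deg: "h p ` {f \<in> bars_space J bar p. \<forall>j. f j \<noteq> 0 \<longrightarrow> P j} \<subseteq>
      h' p ` {f \<in> bars_space J' bar' p. \<forall>j. f j \<noteq> 0 \<longrightarrow> P' j}"
  shows "{j \<in> J. bar j = I \<and> P j} \<lesssim> {j \<in> J'. bar' j = I \<and> P' j}"
proof -
  interpret A: bar_decomposition sc V \<psi> J bar h by fact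
  interpret B: bar_decomposition sc V \<psi> J' bar' h' by fact
  have p': "p \<noteq> -\<infinity>" using p by (simp add: bar_set_def)
  let ?A = "{j \<in> J. bar j = I \<and> P j}" and ?B = "{j \<in> J'. bar' j = I \<and> P' j}"
  have sp: "f \<in> bars_space J bar p" if "f \<in> fin_supp ?A" for f
    using that p by (intro bars_spaceI) (auto simp: fin_supp_def)
  \<comment> \<open>The change of coordinates at the index \<open>p\<close>.\<close>
  define \<phi> where "\<phi> f = inv_into (bars_space J' bar' p) (h' p) (h p f)" for f
  have \<phi>: "\<phi> f \<in> bars_space J' bar' p" "h' p (\<phi> f) = h p f" if "f \<in> bars_space J bar p" for f
  proof -
    have "h p f \<in> h' p ` bars_space J' bar' p"
      using A.h_in[OF p' that] B.h_bij[OF p'] by (simp add: bij_betw_imp_surj_on)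
    then show "\<phi> f \<in> bars_space J' bar' p" "h' p (\<phi> f) = h p f"
      unfolding \<phi>_def by (rule inv_into_into, rule f_inv_into_f)
  qed
  have \<phi>_lin: "\<phi> (\<lambda>j. a * f j + g j) = (\<lambda>j. a * \<phi> f j + \<phi> g j)"
    if "f \<in> bars_space J bar p" "g \<in> bars_space J bar p" for a f g
    using that by (intro B.h_inj[OF p'] \<phi>(1) bars_space_lincomb)
      (simp_all add: \<phi> bars_space_lincomb A.h_lin[OF p'] B.h_lin[OF p'])
  \<comment> \<open>Dropping the other coordinates realises the passage to the quotient by
    \<open>smaller_part\<close>.\<close>
  define T where "T f = (\<lambda>j. if bar' j = I then \<phi> f j else 0)" for f
  show ?thesis
  proof (rule lepoll_of_injective_linear[where T = T])
    show "T (\<lambda>j. a * f j + g j) = (\<lambda>j. a * T f j + T g j)"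
      if "f \<in> fin_supp ?A" "g \<in> fin_supp ?A" for a f g
      using \<phi>_lin[OF sp[OF that(1)] sp[OF that(2)]] by (auto simp: T_def fun_eq_iff)
  next
    fix f :: "'j \<Rightarrow> 'k" assume f: "f \<in> fin_supp ?A"
    have "h p f \<in> h' p ` {f \<in> bars_space J' bar' p. \<forall>j. f j \<noteq> 0 \<longrightarrow> P' j}"
      using deg sp[OF f] f by (auto simp: fin_supp_def)
    then obtain g where g: "g \<in> bars_space J' bar' p" "\<And>j. g j \<noteq> 0 \<Longrightarrow> P' j" "h' p g = h p f"
      by auto
    \<comment> \<open>Coordinates are unique, so \<open>\<phi> f\<close> inherits the degree
      condition from \<open>g\<close>.\<close>
    have "\<phi> f = g" using g(3) by (intro B.h_inj[OF p'] \<phi>(1) g(1) sp f) (simp add: \<phi>(2) sp f)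
    with g have P': "P' j" if "\<phi> f j \<noteq> 0" for j using that by blast
    note supp = bars_space_support[OF \<phi>(1)[OF sp[OF f]]]
    show "T f \<in> fin_supp ?B"
      unfolding fin_supp_def T_def using supp P'
      by (auto intro: finite_subset[OF _ supp(1)] split: if_splits)
    assume "T f = (\<lambda>j. 0)"
    \<comment> \<open>Vanishing of \<open>T f\<close> puts the vector into
      \<open>smaller_part\<close> by the second decomposition; the first one then forces
      \<open>f = 0\<close>.\<close>
    then have "\<phi> f j = 0" if "bar' j = I" for j using that by (auto simp: T_def dest: fun_cong[of _ _ j])
    moreover have "h p f \<in> interval_part V \<psi> I p"
      using f by (intro A.in_interval_partI sp p) (auto simp: fin_supp_def)
    ultimately have "h p f \<in> smaller_part V \<psi> I p"
      using B.smaller_partI[OF \<phi>(1)[OF sp[OF f]] p] by (simp add: \<phi>(2)[OF sp[OF f]])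
    then have "f j = 0" if "bar j = I" for j using A.smaller_partD[OF sp[OF f] p _ that] by blast
    then show "f = (\<lambda>j. 0)" using f by (fastforce simp: fin_supp_def)
  qed
qed

lemma bar_set_nonempty:
  assumes "a \<noteq> \<infinity>" "b \<noteq> -\<infinity>" "a < b" shows "bar_set (a, b) \<noteq> {}"
proof -
  obtain p where "a < p" "p < b" using dense[OF assms(3)] by blast
  then have "p \<in> bar_set (a, b)" by (auto simp: bar_set_def)
  then show ?thesis by blast
qed

text \<open>Schroeder-Bernstein, applied to the comparison in both directions at one index of
  \<open>I\<close>.\<close>

lemma bar_multiplicity_eqpoll:
  assumes 1: "bar_decomposition sc V \<psi> J bar h" and 2: "bar_decomposition sc V \<psi> J' bar' h'"
    and deg: "\<And>p. p \<noteq> -\<infinity> \<Longrightarrow> h p ` {f \<in> bars_space J bar p. \<forall>j. f j \<noteq> 0 \<longrightarrow> P j} =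
      h' p ` {f \<in> bars_space J' bar' p. \<forall>j. f j \<noteq> 0 \<longrightarrow> P' j}"
  shows "{j \<in> J. bar j = I \<and> P j} \<approx> {j \<in> J'. bar' j = I \<and> P' j}"
proof (cases "fst I \<noteq> \<infinity> \<and> snd I \<noteq> -\<infinity> \<and> fst I < snd I")
  case True
  then obtain p where p: "p \<in> bar_set I" using bar_set_nonempty[of "fst I" "snd I"] by auto
  then have "p \<noteq> -\<infinity>" by (simp add: bar_set_def)
  note deg = deg[OF this]
  show ?thesis
    by (rule lepoll_antisym;
        rule bar_multiplicity_lepoll[OF 1 2 p equalityD1[OF deg]]
          bar_multiplicity_lepoll[OF 2 1 p equalityD2[OF deg]])
next
  case False
  then have "{j \<in> J. bar j = I \<and> P j} = {}" "{j \<in> J'. bar' j = I \<and> P' j} = {}"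
    using bar_decomposition.bar_proper[OF 1] bar_decomposition.bar_proper[OF 2] by blast+
  then show ?thesis by (simp only: eqpoll_empty_iff_empty)
qed

section \<open>Translation of barcodes\<close>

text \<open>Subtraction of 1 fixes both infinities, so one formula serves bounded and unbounded
  bars.\<close>

definition shift_bar :: "ereal \<times> ereal \<Rightarrow> ereal \<times> ereal" where
  "shift_bar I = (fst I - 1, snd I - 1)"

lemma ereal_shift_cancel: "x + 1 - 1 = x" "x - 1 + 1 = x" for x :: ereal
  by (cases x; simp add: one_ereal_def)+

lemma ereal_shift_iff [simp]:
  "x - 1 \<le> y - 1 \<longleftrightarrow> x \<le> y" "x - 1 < y - 1 \<longleftrightarrow> x < y" "x + 1 \<le> y + 1 \<longleftrightarrow> x \<le> y"
  "x - 1 = \<infinity> \<longleftrightarrow> x = \<infinity>" "x - 1 = -\<infinity> \<longleftrightarrow> x = -\<infinity>" "x + 1 = -\<infinity> \<longleftrightarrow> x = -\<infinity>"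
  for x y :: ereal
  by (cases x; cases y; simp add: one_ereal_def)+

lemma bar_set_shift: "p \<in> bar_set (shift_bar I) \<longleftrightarrow> p + 1 \<in> bar_set I"
  using ereal_shift_iff(1)[of "fst I" "p + 1"] ereal_shift_iff(2)[of "p + 1" "snd I"]
  unfolding bar_set_def shift_bar_def by (simp add: ereal_shift_cancel)

lemma inj_shift_bar: "shift_bar I = shift_bar I' \<longleftrightarrow> I = I'"
  unfolding shift_bar_def by (metis Pair_inject ereal_shift_cancel(2) prod_eqI)

lemma bars_space_shift: "bars_space J (shift_bar \<circ> bar) p = bars_space J bar (p + 1)"
  by (simp add: bars_space_def basic_space_def bar_set_shift)

lemma bars_map_shift: "bars_map (shift_bar \<circ> bar) q p f = bars_map bar (q + 1) (p + 1) f"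
  by (simp add: bars_map_def basic_map_def bar_set_shift fun_eq_iff)

text \<open>The properties of the Seidel maps that move decompositions. Their effect on degrees
  enters separately, so that the graded and ungraded cases share one argument.\<close>

locale bar_translation = bar_decomposition sc V \<psi> J bar h
  for sc :: "'k::field \<Rightarrow> 'v::ab_group_add \<Rightarrow> 'v" and V \<psi> and J :: "'j set" and bar h +
  fixes S :: "ereal \<Rightarrow> 'v \<Rightarrow> 'v"
  assumes S_lin: "\<And>p. p \<noteq> -\<infinity> \<Longrightarrow> linear_map_on sc (V p) (S p)"
    and S_bij: "\<And>p. p \<noteq> -\<infinity> \<Longrightarrow> bij_betw (S p) (V p) (V (p - 1))"
    and S_comm: "\<And>p q v. p \<noteq> -\<infinity> \<Longrightarrow> p \<le> q \<Longrightarrow> v \<in> V p \<Longrightarrow>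
      S q (\<psi> q p v) = \<psi> (q - 1) (p - 1) (S p v)"
begin

text \<open>A translated bar contains \<open>p\<close> exactly if the original contains
  \<open>p + 1\<close>, and \<open>S (p + 1)\<close> carries \<open>V (p + 1)\<close> to
  \<open>V p\<close>. Commutation with structure maps makes this an isomorphism of persistence
  modules.\<close>

lemma bars_iso_shift: "bars_iso sc V \<psi> J (shift_bar \<circ> bar) (\<lambda>p. S (p + 1) \<circ> h (p + 1))"
  unfolding bars_iso_def bars_space_shift bars_map_shift
proof (intro conjI allI impI ballI)
  fix j assume "j \<in> J"
  then show "fst ((shift_bar \<circ> bar) j) \<noteq> \<infinity>" "snd ((shift_bar \<circ> bar) j) \<noteq> -\<infinity>"
    "fst ((shift_bar \<circ> bar) j) < snd ((shift_bar \<circ> bar) j)"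
    using bar_proper by (auto simp: shift_bar_def)
next
  fix p :: ereal assume p: "p \<noteq> -\<infinity>"
  then have p1: "p + 1 \<noteq> -\<infinity>" by simp
  have S: "bij_betw (S (p + 1)) (V (p + 1)) (V p)"
    using S_bij[OF p1] by (simp add: ereal_shift_cancel)
  show "bij_betw (S (p + 1) \<circ> h (p + 1)) (bars_space J bar (p + 1)) (V p)"
    using h_bij[OF p1] S by (rule bij_betw_trans)
  fix a :: 'k and f g :: "'j \<Rightarrow> 'k" assume fg: "f \<in> bars_space J bar (p + 1)" "g \<in> bars_space J bar (p + 1)"
  show "(S (p + 1) \<circ> h (p + 1)) (\<lambda>j. a * f j + g j) =
      sc a ((S (p + 1) \<circ> h (p + 1)) f) + (S (p + 1) \<circ> h (p + 1)) g"
    using S_lin[OF p1] fg by (simp add: linear_map_on_def h_lin[OF p1] h_in[OF p1])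
next
  fix p q :: ereal and f :: "'j \<Rightarrow> 'k" assume pq: "p \<noteq> -\<infinity> \<and> p \<le> q" and f: "f \<in> bars_space J bar (p + 1)"
  then have p1: "p + 1 \<noteq> -\<infinity>" "p + 1 \<le> q + 1" by simp_all
  show "(S (q + 1) \<circ> h (q + 1)) (bars_map bar (q + 1) (p + 1) f) =
      \<psi> q p ((S (p + 1) \<circ> h (p + 1)) f)"
    using S_comm[OF p1 h_in[OF p1(1) f]] by (simp add: h_map[OF p1 f] ereal_shift_cancel)
qed

text \<open>Uniqueness, applied to the translated and the original decomposition of the same module,
  both indexed by \<open>J\<close>.\<close>

lemma bar_multiplicity_shift:
  assumes deg: "\<And>p. p \<noteq> -\<infinity> \<Longrightarrow> S p ` h p ` {f \<in> bars_space J bar p. \<forall>j. f j \<noteq> 0 \<longrightarrow> P j} =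
      h (p - 1) ` {f \<in> bars_space J bar (p - 1). \<forall>j. f j \<noteq> 0 \<longrightarrow> Q j}"
  shows "{j \<in> J. bar j = I \<and> P j} \<approx> {j \<in> J. bar j = shift_bar I \<and> Q j}"
proof -
  have "{j \<in> J. (shift_bar \<circ> bar) j = shift_bar I \<and> P j} \<approx> {j \<in> J. bar j = shift_bar I \<and> Q j}"
  proof (rule bar_multiplicity_eqpoll)
    show "bar_decomposition sc V \<psi> J bar h"
      by (rule bar_decomposition_axioms)
    show "bar_decomposition sc V \<psi> J (shift_bar \<circ> bar) (\<lambda>p. S (p + 1) \<circ> h (p + 1))"
      by (rule bar_decomposition.intro[OF pm bars_iso_shift])
    show "(S (p + 1) \<circ> h (p + 1)) ` {f \<in> bars_space J (shift_bar \<circ> bar) p. \<forall>j. f j \<noteq> 0 \<longrightarrow> P j} =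
        h p ` {f \<in> bars_space J bar p. \<forall>j. f j \<noteq> 0 \<longrightarrow> Q j}" if "p \<noteq> -\<infinity>" for p
      using deg[of "p + 1"] that
      by (simp add: bars_space_shift ereal_shift_cancel image_comp)
  qed
  then show ?thesis by (simp add: inj_shift_bar)
qed

end

section \<open>Application to the Seidel isomorphisms\<close>

theorem corollary1p29:
  fixes M :: "'e::euclidean_space cstar_mfd"
    and B :: "('e, 'f::euclidean_space) convex_base"
    and N :: nat and \<mu> :: int and x\<^sub>0 :: 'e
    and sc :: "'b::field novikov \<Rightarrow> 'v::ab_group_add \<Rightarrow> 'v"
    and V :: "ereal \<Rightarrow> 'v set"
    and G :: "ereal \<Rightarrow> int \<Rightarrow> 'v set"
    and \<psi> :: "ereal \<Rightarrow> ereal \<Rightarrow> 'v \<Rightarrow> 'v"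
    and S :: "ereal \<Rightarrow> 'v \<Rightarrow> 'v"
  assumes "symplectic_Cstar_manifold TYPE('n::finite) M"
    and "over_convex_base M B"
    and "normalised_moment_map M"
    and "weak_plus_monotone TYPE('n) M"
    and "grading_level TYPE('n) M N"
    and "x\<^sub>0 \<in> pts M" and "mom M x\<^sub>0 = 0" and "weight_sum TYPE('n) M x\<^sub>0 \<mu>"
    and "associated_persistence_module TYPE('n) M N \<mu> sc V G \<psi> S"
  shows "(\<forall>(J :: 'j set) bar. is_barcode sc V \<psi> J bar \<longrightarrow>
      (\<forall>(a::real) (b::ereal). ereal a < b \<longrightarrow>
         {j \<in> J. bar j = (ereal a, b)} \<approx> {j \<in> J. bar j = (ereal (a - 1), b - 1)}) \<and>
      (\<forall>b::ereal. b \<noteq> -\<infinity> \<longrightarrow>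
         {j \<in> J. bar j = (-\<infinity>, b)} \<approx> {j \<in> J. bar j = (-\<infinity>, b - 1)})) \<and>
    (\<forall>(J :: 'j set) bar d. is_graded_barcode sc N V G \<psi> J bar d \<longrightarrow>
      (\<forall>k::int.
        (\<forall>(a::real) (b::ereal). ereal a < b \<longrightarrow>
           {j \<in> J. bar j = (ereal a, b) \<and> same_degree N (d j) k} \<approx>
           {j \<in> J. bar j = (ereal (a - 1), b - 1) \<and> same_degree N (d j) (k + 2 * \<mu>)}) \<and>
        (\<forall>b::ereal. b \<noteq> -\<infinity> \<longrightarrow>
           {j \<in> J. bar j = (-\<infinity>, b) \<and> same_degree N (d j) k} \<approx>
           {j \<in> J. bar j = (-\<infinity>, b - 1) \<and> same_degree N (d j) (k + 2 * \<mu>)})))"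
proof -
  obtain D K L \<theta> where gpm: "graded_persistence_module sc N V G \<psi>"
    and seidel: "seidel_part TYPE('n) M \<mu> D L \<theta> sc V G \<psi> S"
    using assms(9) unfolding associated_persistence_module_def by (elim conjE exE)
  have S_at: "\<forall>p. p \<noteq> -\<infinity> \<longrightarrow> linear_map_on sc (V p) (S p) \<and> bij_betw (S p) (V p) (V (p - 1)) \<and>
      (\<forall>k. S p ` G p k = G (p - 1) (k + 2 * \<mu>))"
    using seidel unfolding seidel_part_def by (elim conjE)
  have S_comm: "\<forall>p q. p \<noteq> -\<infinity> \<and> p \<le> q \<longrightarrow>
      (\<forall>v\<in>V p. S q (\<psi> q p v) = \<psi> (q - 1) (p - 1) (S p v))"
    using seidel unfolding seidel_part_def by (elim conjE)
  have S: "linear_map_on sc (V p) (S p)" "bij_betw (S p) (V p) (V (p - 1))"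
      "p \<le> q \<Longrightarrow> v \<in> V p \<Longrightarrow> S q (\<psi> q p v) = \<psi> (q - 1) (p - 1) (S p v)"
      "S p ` G p k = G (p - 1) (k + 2 * \<mu>)" if "p \<noteq> -\<infinity>" for p q v k
    using that S_at S_comm by simp_all
  have pm: "persistence_module sc V \<psi>" using gpm by (simp add: graded_persistence_module_def)
  have shift: "shift_bar (ereal a, b) = (ereal (a - 1), b - 1)" "shift_bar (-\<infinity>, b) = (-\<infinity>, b - 1)"
    for a b by (simp_all add: shift_bar_def one_ereal_def)
  have ungraded: "{j \<in> J. bar j = I} \<approx> {j \<in> J. bar j = shift_bar I}"
    if bc: "is_barcode sc V \<psi> J bar" for J :: "'j set" and bar I
  proof -
    obtain h where h: "bars_iso sc V \<psi> J bar h" using bc by (auto simp: is_barcode_def)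
    then interpret bar_translation sc V \<psi> J bar h S
      by (intro bar_translation.intro bar_decomposition.intro bar_translation_axioms.intro pm S(1-3))
    \<comment> \<open>With constantly true predicates, the condition on degrees says that
      \<open>S p\<close> maps \<open>V p\<close> onto \<open>V (p - 1)\<close>.\<close>
    have "h p ` bars_space J bar p = V p" if "p \<noteq> -\<infinity>" for p
      using h_bij[OF that] by (rule bij_betw_imp_surj_on)
    moreover have "S p ` V p = V (p - 1)" if "p \<noteq> -\<infinity>" for p
      using S_bij[OF that] by (rule bij_betw_imp_surj_on)
    ultimately show ?thesis
      using bar_multiplicity_shift[of "\<lambda>_. True" "\<lambda>_. True" I] by simp
  qed
  have graded: "{j \<in> J. bar j = I \<and> same_degree N (d j) k} \<approx>
      {j \<in> J. bar j = shift_bar I \<and> same_degree N (d j) (k + 2 * \<mu>)}"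
    if bc: "is_graded_barcode sc N V G \<psi> J bar d" for J :: "'j set" and bar d I k
  proof -
    obtain h where h: "bars_iso sc V \<psi> J bar h" and im: "\<And>p k. p \<noteq> -\<infinity> \<Longrightarrow>
        h p ` {f \<in> bars_space J bar p. \<forall>j. f j \<noteq> 0 \<longrightarrow> same_degree N (d j) k} = G p k"
      using bc unfolding is_graded_barcode_def by blast
    interpret bar_translation sc V \<psi> J bar h S
      by (intro bar_translation.intro bar_decomposition.intro bar_translation_axioms.intro pm h S(1-3))
    \<comment> \<open>The bars of degree \<open>k\<close> span \<open>G p k\<close>, which
      \<open>S p\<close> carries onto \<open>G (p - 1) (k + 2 * \<mu>)\<close>, the span of the bars
      of degree \<open>k + 2 * \<mu>\<close>.\<close>
    show ?thesis
      by (rule bar_multiplicity_shift) (simp add: im S(4))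
  qed
  show ?thesis
    unfolding shift[symmetric] by (intro conjI allI impI; (rule ungraded | rule graded); assumption)
qed

end
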